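(* Let $F$ be a finite field with $q$ elements, and let $UT_3$ be the algebra of $3\times 3$ upper triangular matrices over $F$ with the $\mathbb{Z}_2$-grading $\mathcal{A}^{(0)}=\mathrm{span}_F\{e_{11},e_{22},e_{33},e_{23}\}$, $\mathcal{A}^{(1)}=\mathrm{span}_F\{e_{12},e_{13}\}$. Let $\Omega_1=\{[y_1,y_2],\,y_2^q-y_2\}$ and $\Omega_2=\{[y_3,y_4],\,y_4^q-y_4\}$. Then a basis of the superidentities of $UT_3$ with this grading is given by the polynomials $$z_1z_2,\qquad w_1z_1,\qquad w_1w_2\qquad (w_1\in\Omega_1,\ w_2\in\Omega_2),$$ i.e. these polynomials generate $\mathrm{Id}(\mathcal{A}^{(0)},\mathcal{A}^{(1)})$ as a $T_2$-ideal. Moreover, a linear basis of the vector space $F\langle Y\cup Z\rangle/\mathrm{Id}(\mathcal{A}^{(0)},\mathcal{A}^{(1)})$ is given by the images of the (distinct) polynomials of the form $$y_1^{r_1}\cdots y_m^{r_m}\,[z_j,y_{j_1}^{(s_1)},\ldots,y_{j_n}^{(s_n)}]^{\theta_1}\,p^{\theta_2},$$ where $m,n,j\in\mathbb{N}$, $j_1<\cdots<j_n$, $0\le r_1,\ldots,r_m,s_1,\ldots,s_n<q$, $p$ is an ordered $q$-commutator, $\theta_1,\theta_2\in\{0,1\}$ and $\sum_{i=1}^m r_i+\theta_1+\theta_2\ge 1$.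
   Context: $F\langle Y\cup Z\rangle$ is the free non-unitary associative $F$-algebra freely generated by $Y\cup Z$, $Y=\{y_1,y_2,\ldots\}$, $Z=\{z_1,z_2,\ldots\}$. It is a superalgebra ($\mathbb{Z}_2$-graded algebra) $\mathcal{F}^{(0)}\oplus\mathcal{F}^{(1)}$, where $\mathcal{F}^{(1)}$ is spanned by monomials with an odd number of occurrences of variables from $Z$ and $\mathcal{F}^{(0)}$ by the remaining monomials. A homomorphism of superalgebras is an algebra homomorphism preserving the grading. A $T_2$-ideal is a two-sided ideal invariant under all superalgebra endomorphisms of $F\langle Y\cup Z\rangle$; a set $S$ is a basis of a $T_2$-ideal $I$ if $I$ is the $T_2$-ideal $\langle S\rangle_{T_2}$ generated by $S$. A polynomial $f(y_1,\ldots,y_m,z_1,\ldots,z_n)$ is a polynomial superidentity of a superalgebra $\mathcal{A}^{(0)}\oplus\mathcal{A}^{(1)}$ if it vanishes whenever each $y_i$ is replaced by an element of $\mathcal{A}^{(0)}$ and each $z_i$ by an element of $\mathcal{A}^{(1)}$; $\mathrm{Id}(\mathcal{A}^{(0)},\mathcal{A}^{(1)})$ is the $T_2$-ideal of all its superidentities. Commutators are left normed: $[u_1,u_2]=u_1u_2-u_2u_1$, $[u_1,\ldots,u_m]=[[u_1,\ldots,u_{m-1}],u_m]$ for $m>2$. Inside commutators, $[u,v^{(0)}]=u$ and $[u,v^{(r)}]=[[u,v^{(r-1)}],v]$ for $r\ge 1$ (so $[z_j,y_{j_1}^{(0)},\ldots,y_{j_n}^{(0)}]=z_j$). A factor with exponent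 $0$ in a product is omitted. $e_{ij}$ denote the elementary matrices. An ordered $q$-commutator is a polynomial $p$ in variables from $Y$ of one of the two forms: (i) $p=[y_{j_1},y_{j_2}^{(s_2)},y_{j_1}^{(s_1-1)},y_{j_3}^{(s_3)},\ldots,y_{j_n}^{(s_n)}]$ with $n\ge 2$, distinct indices $j_i$, $j_1>j_2<j_3<\cdots<j_n$, and $1\le s_1,\ldots,s_n<q$; or (ii) $p=[y_{l_1}^q-y_{l_1},y_{l_2}^{(t_2)},\ldots,y_{l_k}^{(t_k)}]$ with $k\ge 1$, distinct indices $l_i$, $l_2<\cdots<l_k$, and $0\le t_2,\ldots,t_k<q$ (so $y_{l_1}^q-y_{l_1}$ itself is included). *)

theory Defs
  imports "HOL-Analysis.Finite_Cartesian_Product" "HOL-Library.Poly_Mapping"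
begin

section \<open>The free superalgebra\<close>

text \<open>Indices start at 0: \<open>Y i\<close> and \<open>Z i\<close> are the variables \<open>y\<^sub>i\<^sub>+\<^sub>1\<close> and \<open>z\<^sub>i\<^sub>+\<^sub>1\<close> of the usual
  enumerations \<open>y\<^sub>1, y\<^sub>2, \<dots>\<close> and \<open>z\<^sub>1, z\<^sub>2, \<dots>\<close>.\<close>

datatype var = Y nat | Z nat

text \<open>Lists under concatenation are the free monoid, so that the convolution product of
  \<^theory>\<open>HOL-Library.Poly_Mapping\<close> on \<^typ>\<open>var list \<Rightarrow>\<^sub>0 'a::field\<close> is the product of the free
  \<^emph>\<open>unitary\<close> associative algebra.  The free non-unitary algebra is the subalgebra \<open>FYZ\<close> below;
  the unit is only used to write products in which all factors may be omitted.\<close>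

instantiation list :: (type) monoid_add
begin
definition zero_list :: "'a list" where "zero_list = []"
definition plus_list :: "'a list \<Rightarrow> 'a list \<Rightarrow> 'a list" where "plus_list = (@)"
instance by standard (simp_all add: zero_list_def plus_list_def)
end

type_synonym 'a fpoly = "var list \<Rightarrow>\<^sub>0 'a"

definition monomial :: "var list \<Rightarrow> 'a::field fpoly" where
  "monomial w = Poly_Mapping.single w 1"

definition yvar :: "nat \<Rightarrow> 'a::field fpoly" where "yvar i = monomial [Y i]"
definition zvar :: "nat \<Rightarrow> 'a::field fpoly" where "zvar i = monomial [Z i]"

definition fscale :: "'a::field \<Rightarrow> 'a fpoly \<Rightarrow> 'a fpoly" where
  "fscale c f = Poly_Mapping.map ((*) c) f"

lemma lookup_fscale [simp]: "Poly_Mapping.lookup (fscale c f) w = c * Poly_Mapping.lookup f w"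
  by (simp add: fscale_def Poly_Mapping.map.rep_eq when_def)

interpretation free: vector_space fscale
  by standard (auto intro!: poly_mapping_eqI simp: lookup_add algebra_simps)

definition z_degree :: "var list \<Rightarrow> nat" where
  "z_degree w = length (filter (\<lambda>v. \<exists>i. v = Z i) w)"

definition FYZ :: "'a::field fpoly set" where
  "FYZ = free.span {monomial w |w. w \<noteq> []}"

definition F_even :: "'a::field fpoly set" where
  "F_even = free.span {monomial w |w. w \<noteq> [] \<and> even (z_degree w)}"

definition F_odd :: "'a::field fpoly set" where
  "F_odd = free.span {monomial w |w. w \<noteq> [] \<and> odd (z_degree w)}"

text \<open>Only the values on \<open>FYZ\<close> matter.\<close>

definition super_endo :: "('a::field fpoly \<Rightarrow> 'a fpoly) \<Rightarrow> bool" where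
  "super_endo \<phi> \<longleftrightarrow>
     (\<forall>f\<in>FYZ. \<phi> f \<in> FYZ) \<and>
     (\<forall>f\<in>FYZ. \<forall>g\<in>FYZ. \<phi> (f + g) = \<phi> f + \<phi> g) \<and>
     (\<forall>c. \<forall>f\<in>FYZ. \<phi> (fscale c f) = fscale c (\<phi> f)) \<and>
     (\<forall>f\<in>FYZ. \<forall>g\<in>FYZ. \<phi> (f * g) = \<phi> f * \<phi> g) \<and>
     \<phi> ` F_even \<subseteq> F_even \<and> \<phi> ` F_odd \<subseteq> F_odd"

definition T2_ideal :: "'a::field fpoly set \<Rightarrow> bool" where
  "T2_ideal I \<longleftrightarrow>
     I \<subseteq> FYZ \<and> free.subspace I \<and>
     (\<forall>f\<in>I. \<forall>g\<in>FYZ. f * g \<in> I \<and> g * f \<in> I) \<and>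
     (\<forall>\<phi>. super_endo \<phi> \<longrightarrow> \<phi> ` I \<subseteq> I)"

definition T2_generated :: "'a::field fpoly set \<Rightarrow> 'a fpoly set" where
  "T2_generated S = \<Inter>{I. T2_ideal I \<and> S \<subseteq> I}"


section \<open>Superidentities of matrix superalgebras\<close>

definition mat_scale :: "'a::field \<Rightarrow> 'a^'n^'m \<Rightarrow> 'a^'n^'m" where
  "mat_scale c A = (\<chi> i j. c * A $ i $ j)"

interpretation mats: vector_space "mat_scale :: 'a::field \<Rightarrow> 'a^'n^'m \<Rightarrow> 'a^'n^'m"
  by standard (simp_all add: mat_scale_def vec_eq_iff algebra_simps)

definition word_eval :: "(var \<Rightarrow> 'a::field^'n^'n) \<Rightarrow> var list \<Rightarrow> 'a^'n^'n" where
  "word_eval \<sigma> w = foldr (\<lambda>v M. \<sigma> v ** M) w (mat 1)"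

definition poly_eval :: "(var \<Rightarrow> 'a::field^'n^'n) \<Rightarrow> 'a fpoly \<Rightarrow> 'a^'n^'n" where
  "poly_eval \<sigma> f = (\<Sum>w\<in>Poly_Mapping.keys f. mat_scale (Poly_Mapping.lookup f w) (word_eval \<sigma> w))"

text \<open>\<open>super_ids A0 A1\<close> is \<open>Id(A0, A1)\<close> for a superalgebra of matrices with even part \<open>A0\<close> and odd
  part \<open>A1\<close>.\<close>

definition super_ids :: "('a::field^'n^'n) set \<Rightarrow> ('a^'n^'n) set \<Rightarrow> 'a fpoly set" where
  "super_ids A0 A1 =
     {f \<in> FYZ. \<forall>\<sigma>. (\<forall>i. \<sigma> (Y i) \<in> A0) \<and> (\<forall>i. \<sigma> (Z i) \<in> A1) \<longrightarrow> poly_eval \<sigma> f = 0}"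

definition e_mat :: "3 \<Rightarrow> 3 \<Rightarrow> 'a::field^3^3" where
  "e_mat i j = (\<chi> k l. if k = i \<and> l = j then 1 else 0)"

definition UT3_even :: "('a::field^3^3) set" where
  "UT3_even = mats.span {e_mat 1 1, e_mat 2 2, e_mat 3 3, e_mat 2 3}"

definition UT3_odd :: "('a::field^3^3) set" where
  "UT3_odd = mats.span {e_mat 1 2, e_mat 1 3}"

abbreviation Id_UT3 :: "'a::field fpoly set" where
  "Id_UT3 \<equiv> super_ids UT3_even UT3_odd"


section \<open>The quotient by the superidentities\<close>

lemma poly_eval_superset:
  assumes "finite A" "Poly_Mapping.keys f \<subseteq> A"
  shows "poly_eval \<sigma> f = (\<Sum>w\<in>A. mat_scale (Poly_Mapping.lookup f w) (word_eval \<sigma> w))"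
  unfolding poly_eval_def using assms
  by (intro sum.mono_neutral_left) (auto simp: in_keys_iff)

lemma poly_eval_add: "poly_eval \<sigma> (f + g) = poly_eval \<sigma> f + poly_eval \<sigma> g"
proof -
  let ?A = "Poly_Mapping.keys f \<union> Poly_Mapping.keys g"
  have "Poly_Mapping.keys (f + g) \<subseteq> ?A" by (rule keys_add)
  then show ?thesis
    by (simp add: poly_eval_superset[of ?A] lookup_add mats.scale_left_distrib sum.distrib)
qed

lemma poly_eval_fscale: "poly_eval \<sigma> (fscale c f) = mat_scale c (poly_eval \<sigma> f)"
proof -
  have "Poly_Mapping.keys (fscale c f) \<subseteq> Poly_Mapping.keys f" by (auto simp: in_keys_iff)
  then show ?thesis
    by (simp add: poly_eval_superset[of "Poly_Mapping.keys f"] mats.scale_sum_right)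
qed

lemma subspace_super_ids: "free.subspace (super_ids A0 A1)"
proof -
  have "free.subspace FYZ" by (simp add: FYZ_def)
  then show ?thesis
    unfolding free.subspace_def super_ids_def
    by (auto simp: poly_eval_add poly_eval_fscale) (simp add: poly_eval_def)
qed

text \<open>The quotient of the free unitary algebra by \<open>Id_UT3\<close>.  As \<open>Id_UT3 \<subseteq> FYZ\<close>, the space
  \<open>FYZ / Id_UT3\<close> is its subspace \<open>abs_relfree ` FYZ\<close>, where \<open>abs_relfree\<close> is the canonical
  projection.\<close>

quotient_type (overloaded) 'a relfree = "'a::field fpoly" / "\<lambda>f g. f - g \<in> Id_UT3"
proof (intro equivpI reflpI sympI transpI)
  fix f g h :: "'a fpoly"
  show "f - f \<in> Id_UT3"
    by (simp add: free.subspace_0[OF subspace_super_ids])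
  show "g - f \<in> Id_UT3" if "f - g \<in> Id_UT3"
    using free.subspace_neg[OF subspace_super_ids that] by simp
  show "f - h \<in> Id_UT3" if "f - g \<in> Id_UT3" "g - h \<in> Id_UT3"
    using free.subspace_add[OF subspace_super_ids that] by simp
qed

instantiation relfree :: (field) ab_group_add
begin

lift_definition zero_relfree :: "'a relfree" is 0 .

lift_definition plus_relfree :: "'a relfree \<Rightarrow> 'a relfree \<Rightarrow> 'a relfree" is "(+)"
  by (metis add_diff_add free.subspace_add subspace_super_ids)

lift_definition uminus_relfree :: "'a relfree \<Rightarrow> 'a relfree" is uminus
  by (metis minus_diff_minus free.subspace_neg subspace_super_ids)

definition minus_relfree :: "'a relfree \<Rightarrow> 'a relfree \<Rightarrow> 'a relfree" where
  "minus_relfree a b = a + - b"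

instance
  by standard
    (unfold minus_relfree_def,
     (transfer, simp add: free.subspace_0[OF subspace_super_ids] algebra_simps)+, simp?)

end

lift_definition rscale :: "'a::field \<Rightarrow> 'a relfree \<Rightarrow> 'a relfree" is fscale
  by (metis free.scale_right_diff_distrib free.subspace_scale subspace_super_ids)

interpretation quot: vector_space rscale
  by standard
    (transfer, simp add: free.subspace_0[OF subspace_super_ids]
       free.scale_right_distrib free.scale_left_distrib)+


section \<open>Commutators\<close>

definition comm :: "'a::field fpoly \<Rightarrow> 'a fpoly \<Rightarrow> 'a fpoly" where
  "comm u v = u * v - v * u"

text \<open>A pair \<open>(v, r)\<close> in the list stands for \<open>r\<close> successive entries \<open>v\<close>.\<close>

definition lcomm :: "'a::field fpoly \<Rightarrow> ('a fpoly \<times> nat) list \<Rightarrow> 'a fpoly" where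
  "lcomm = foldl (\<lambda>u (v, r). ((\<lambda>x. comm x v) ^^ r) u)"

abbreviation ypow :: "(nat \<times> nat) list \<Rightarrow> ('a::field fpoly \<times> nat) list" where
  "ypow \<equiv> map (\<lambda>(j, s). (yvar j, s))"

text \<open>In \<open>form1\<close>, \<open>js\<close> is \<open>[(j\<^sub>3,s\<^sub>3),\<dots>,(j\<^sub>n,s\<^sub>n)]\<close>; in \<open>form2\<close>, \<open>ls\<close> is
  \<open>[(l\<^sub>2,t\<^sub>2),\<dots>,(l\<^sub>k,t\<^sub>k)]\<close>.\<close>

inductive ordered_q_commutator :: "nat \<Rightarrow> 'a::field fpoly \<Rightarrow> bool" for q where
  form1: "ordered_q_commutator q (lcomm (yvar j1) ((yvar j2, s2) # (yvar j1, s1 - 1) # ypow js))"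
    if "distinct (j1 # j2 # map fst js)"
       "j1 > j2" "sorted_wrt (<) (j2 # map fst js)"
       "1 \<le> s1" "s1 < q" "1 \<le> s2" "s2 < q" "\<forall>(j, s)\<in>set js. 1 \<le> s \<and> s < q"
| form2: "ordered_q_commutator q (lcomm (yvar l1 ^ q - yvar l1) (ypow ls))"
    if "distinct (l1 # map fst ls)" "sorted_wrt (<) (map fst ls)"
       "\<forall>(l, t)\<in>set ls. t < q"

text \<open>The claimed linear basis.  Being a set, it contains each polynomial once, however many
  parameter choices produce it.\<close>

definition basis_polys :: "nat \<Rightarrow> 'a::field fpoly set" where
  "basis_polys q =
     {prod_list (map (\<lambda>i. yvar i ^ r i) [0..<m]) * lcomm (zvar j) (ypow js) ^ \<theta>1 * p ^ \<theta>2
       | m r j js p \<theta>1 \<theta>2.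
         (\<forall>i<m. r i < q) \<and>
         sorted_wrt (<) (map fst js) \<and> (\<forall>(k, s)\<in>set js. s < q) \<and>
         ordered_q_commutator q p \<and>
         \<theta>1 \<in> {0, 1} \<and> \<theta>2 \<in> {0, 1} \<and>
         (\<Sum>i<m. r i) + \<theta>1 + \<theta>2 \<ge> 1}"

definition Omega1 :: "nat \<Rightarrow> 'a::field fpoly set" where
  "Omega1 q = {comm (yvar 0) (yvar 1), yvar 1 ^ q - yvar 1}"

definition Omega2 :: "nat \<Rightarrow> 'a::field fpoly set" where
  "Omega2 q = {comm (yvar 2) (yvar 3), yvar 3 ^ q - yvar 3}"

end

theory Submission
  imports Defs "HOL-Computational_Algebra.Polynomial" "HOL-Analysis.Cartesian_Space"
begin

text \<open>Modulo a \<open>T\<^sub>2\<close>-ideal \<open>J\<close> containing the generators, call \<open>t\<close> killed if \<open>[a, b] t\<close>,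
  \<open>(a\<^sup>q - a) t\<close> and their mirror images lie in \<open>J\<close> for all even \<open>a, b\<close>.  Commutators and elements
  \<open>a\<^sup>q - a\<close> are killed, and on killed elements the maps \<open>D\<^sub>i = [\<cdot>, y\<^sub>i]\<close> commute modulo \<open>J\<close> and satisfy
  \<open>D\<^sub>i\<^sup>q = D\<^sub>i\<close>, because \<open>[t, y\<^sup>(\<^sup>q\<^sup>)] = [t, y\<^sup>q]\<close> holds exactly.  Together with the Jacobi identity this rewrites
  the pure \<open>y\<close>-part into ordered \<open>q\<close>-commutators; words with one \<open>z\<close> follow from
  \<open>t y = y t + [t, y]\<close>, and words with two vanish.  Conversely, at a generic point of \<open>UT\<^sub>3\<close> the four
  entries \<open>(1,1)\<close>, \<open>(1,2)\<close>, \<open>(2,3)\<close>, \<open>(1,3)\<close> separate the four kinds of basis elements, and the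
  values reduce to reduced monomials over \<open>F\<close>, which are independent functions.  So the basis is
  independent modulo the superidentities, and the spanning statement for \<open>J\<close> forces \<open>J\<close> to contain
  all of them.\<close>

section \<open>The free algebra\<close>

text \<open>The relations act from one side: a commutator annihilates an odd element standing to its
  right, while an odd element followed by a commutator may survive, as \<open>e12 e23 = e13\<close>
  shows. So the letters before the \<open>z\<close> can be reordered and reduced freely, whereas
  corrections made behind it leave an ordered commutator as last factor; this asymmetry dictates the
  shape of the basis. In form (i) the bound \<open>q - 1\<close> concerns the total multiplicity of
  a letter, the two entries of the innermost commutator included, so the rewriting has to count
  these too. The basis is given as a set with redundant parameters (zero exponents, the bound
  \<open>m\<close>, a \<open>p\<close> with exponent 0). It is re-indexed by multisets, and
  independence is proved for the indexed family, which also shows that distinct basis polynomials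
  stay distinct modulo the identities. In place of the Frobenius map the proof counts roots: a
  polynomial of degree below \<open>q\<close> that vanishes on the whole field is zero.\<close>

lemma monomial_Nil: "monomial [] = 1"
  unfolding monomial_def by (metis single_one zero_list_def)

lemma single_mult_word:
  "Poly_Mapping.single u a * Poly_Mapping.single v b = Poly_Mapping.single (u @ v) (a * b)"
  by (simp add: mult_single plus_list_def)

lemma monomial_mult: "monomial u * monomial v = monomial (u @ v)"
  by (simp add: monomial_def mult_single plus_list_def)

lemma fscale_eq_mult: "fscale c f = Poly_Mapping.single [] c * f"
  unfolding fscale_def by (metis mult_map_scale_conv_mult zero_list_def)

lemma monomial_expansion:
  "f = (\<Sum>w\<in>Poly_Mapping.keys f. fscale (Poly_Mapping.lookup f w) (monomial w))"
proof (rule poly_mapping_eqI)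
  fix v
  have "Poly_Mapping.lookup (\<Sum>w\<in>Poly_Mapping.keys f. fscale (Poly_Mapping.lookup f w) (monomial w)) v
      = (\<Sum>w\<in>Poly_Mapping.keys f. if w = v then Poly_Mapping.lookup f w else 0)"
    unfolding lookup_sum by (intro sum.cong) (auto simp: monomial_def lookup_single when_def)
  also have "\<dots> = Poly_Mapping.lookup f v"
    by (auto simp: in_keys_iff)
  finally show "Poly_Mapping.lookup f v
    = Poly_Mapping.lookup (\<Sum>w\<in>Poly_Mapping.keys f. fscale (Poly_Mapping.lookup f w) (monomial w)) v" ..
qed

lemma span_monomials:
  "free.span {monomial w |w. P w} = {f :: 'a::field fpoly. \<forall>w\<in>Poly_Mapping.keys f. P w}" (is "?L = ?R")
proof
  have "free.subspace ?R"
    by (rule free.subspaceI) (force simp: in_keys_iff lookup_add)+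
  moreover have "{monomial w |w. P w} \<subseteq> ?R" by (auto simp: monomial_def)
  ultimately show "?L \<subseteq> ?R" by (rule free.span_minimal[rotated])
  show "?R \<subseteq> ?L"
  proof
    fix f :: "'a fpoly" assume "f \<in> ?R"
    then have "(\<Sum>w\<in>Poly_Mapping.keys f. fscale (Poly_Mapping.lookup f w) (monomial w)) \<in> ?L"
      by (intro free.span_sum free.span_scale free.span_base) auto
    then show "f \<in> ?L" using monomial_expansion[of f] by simp
  qed
qed

lemma span_all_monomials: "free.span (range monomial) = UNIV"
  using span_monomials[of "\<lambda>_. True"] by (simp add: full_SetCompr_eq)

lemma fscale_mult_left: "fscale c f * g = fscale c (f * g)"
  by (simp add: fscale_eq_mult mult.assoc)

lemma fscale_mult_right:
  fixes c :: "'a::field"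
  shows "f * fscale c g = fscale c (f * g)"
proof -
  have central: "f * Poly_Mapping.single [] c = Poly_Mapping.single [] c * f" for f :: "'a fpoly"
  proof -
    have "f \<in> free.span (range monomial)" by (simp add: span_all_monomials)
    then show ?thesis
    proof (induction rule: free.span_induct_alt)
      case (step d x g)
      then obtain w where "x = monomial w" by auto
      then have "x * Poly_Mapping.single [] c = Poly_Mapping.single [] c * x"
        by (simp only: monomial_def single_mult_word) simp
      moreover have "Poly_Mapping.single [] d * Poly_Mapping.single [] c
          = Poly_Mapping.single [] c * (Poly_Mapping.single [] d :: 'a fpoly)"
        by (simp only: single_mult_word) (simp add: mult.commute)
      ultimately have "fscale d x * Poly_Mapping.single [] c = Poly_Mapping.single [] c * fscale d x"
        unfolding fscale_eq_mult by (simp only: mult.assoc) (simp only: mult.assoc[symmetric])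
      with step.IH show ?case by (simp only: distrib_left distrib_right)
    qed simp
  qed
  show ?thesis by (simp only: fscale_eq_mult central mult.assoc[symmetric])
qed

text \<open>Bilinearity reduces inclusions between products of spans to products of words; all
  parity rules below come from this.\<close>

lemma span_mult_closed:
  assumes "\<And>a b. a \<in> A \<Longrightarrow> b \<in> B \<Longrightarrow> a * b \<in> free.span C"
    and x: "x \<in> free.span A" and y: "y \<in> free.span B"
  shows "x * y \<in> free.span C"
proof -
  have ay: "a * y \<in> free.span C" if "a \<in> A" for a
    using y
  proof (induction rule: free.span_induct_alt)
    case (step c b z)
    then show ?case using assms(1)[OF that, of b]
      by (simp add: distrib_left fscale_mult_right free.span_add free.span_scale)
  qed (simp add: free.span_zero)
  show ?thesis using x
  proof (induction rule: free.span_induct_alt)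
    case (step c a z)
    then show ?case using ay
      by (simp add: distrib_right fscale_mult_left free.span_add free.span_scale)
  qed (simp add: free.span_zero)
qed

lemma z_degree_simps [simp]:
  "z_degree [] = 0" "z_degree (Y i # w) = z_degree w" "z_degree (Z i # w) = Suc (z_degree w)"
  "z_degree (u @ v) = z_degree u + z_degree v" "z_degree (map Y k) = 0"
  by (auto simp: z_degree_def)

lemma FYZ_iff: "f \<in> FYZ \<longleftrightarrow> [] \<notin> Poly_Mapping.keys f"
  unfolding FYZ_def span_monomials by auto

lemma F_even_iff: "f \<in> F_even \<longleftrightarrow> (\<forall>w\<in>Poly_Mapping.keys f. w \<noteq> [] \<and> even (z_degree w))"
  unfolding F_even_def span_monomials by auto

lemma F_odd_iff: "f \<in> F_odd \<longleftrightarrow> (\<forall>w\<in>Poly_Mapping.keys f. w \<noteq> [] \<and> odd (z_degree w))"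
  unfolding F_odd_def span_monomials by auto

lemma F_even_subset_FYZ: "F_even \<subseteq> FYZ" and F_odd_subset_FYZ: "F_odd \<subseteq> FYZ"
  by (auto simp: FYZ_iff F_even_iff F_odd_iff)

lemma subspace_FYZ: "free.subspace FYZ" and subspace_F_even: "free.subspace F_even"
  and subspace_F_odd: "free.subspace F_odd"
  by (simp_all add: FYZ_def F_even_def F_odd_def)

lemma monomial_in_FYZ [simp]: "monomial w \<in> FYZ \<longleftrightarrow> w \<noteq> []"
  and monomial_in_F_even: "monomial w \<in> F_even \<longleftrightarrow> w \<noteq> [] \<and> even (z_degree w)"
  and monomial_in_F_odd: "monomial w \<in> F_odd \<longleftrightarrow> w \<noteq> [] \<and> odd (z_degree w)"
  by (auto simp: FYZ_iff F_even_iff F_odd_iff monomial_def)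

lemma yvar_in_F_even: "yvar i \<in> F_even" and zvar_in_F_odd: "zvar i \<in> F_odd"
  by (simp_all add: zvar_def yvar_def monomial_in_F_odd monomial_in_F_even)

lemma F_even_mult: "f \<in> F_even \<Longrightarrow> g \<in> F_even \<Longrightarrow> f * g \<in> F_even"
  unfolding F_even_def
  by (rule span_mult_closed) (auto simp: monomial_mult intro!: free.span_base)

lemma F_even_odd_mult: "f \<in> F_even \<Longrightarrow> g \<in> F_odd \<Longrightarrow> f * g \<in> F_odd"
  unfolding F_even_def F_odd_def
  by (rule span_mult_closed) (auto simp: monomial_mult intro!: free.span_base)

lemma F_odd_even_mult: "f \<in> F_odd \<Longrightarrow> g \<in> F_even \<Longrightarrow> f * g \<in> F_odd"
  unfolding F_even_def F_odd_def
  by (rule span_mult_closed) (auto simp: monomial_mult intro!: free.span_base)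

lemma F_odd_mult: "f \<in> F_odd \<Longrightarrow> g \<in> F_odd \<Longrightarrow> f * g \<in> F_even"
  unfolding F_even_def F_odd_def
  by (rule span_mult_closed) (auto simp: monomial_mult intro!: free.span_base)

text \<open>The non-unitary algebra is an ideal of the unitary one, so only one factor has to lack a
  constant term.\<close>

lemma FYZ_mult: "f \<in> FYZ \<Longrightarrow> f * g \<in> FYZ" "f \<in> FYZ \<Longrightarrow> g * f \<in> FYZ"
proof -
  have g: "g \<in> free.span (range monomial)" by (simp add: span_all_monomials)
  show "f * g \<in> FYZ" if "f \<in> FYZ" using that g unfolding FYZ_def
    by (rule span_mult_closed[rotated]) (auto simp: monomial_mult intro!: free.span_base)
  show "g * f \<in> FYZ" if "f \<in> FYZ" using g that unfolding FYZ_def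
    by (rule span_mult_closed[rotated]) (auto simp: monomial_mult intro!: free.span_base)
qed

lemma FYZ_minus_const: "\<exists>c. f - fscale c 1 \<in> FYZ"
  by (rule exI[of _ "Poly_Mapping.lookup f []"])
     (simp add: FYZ_iff in_keys_iff lookup_minus monomial_Nil[symmetric], simp add: monomial_def)

lemma comm_in_F_even: "a \<in> F_even \<Longrightarrow> b \<in> F_even \<Longrightarrow> comm a b \<in> F_even"
  unfolding comm_def by (intro free.subspace_diff[OF subspace_F_even] F_even_mult)

lemma power_in_F_even: "a \<in> F_even \<Longrightarrow> n > 0 \<Longrightarrow> a ^ n \<in> F_even"
  by (induction n) (auto simp: F_even_mult, metis F_even_mult gr0I mult.right_neutral power_0)

text \<open>Splitting off the constant term of \<open>g\<close> leaves an element of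
  \<open>FYZ\<close> and a scalar multiple of \<open>f\<close>. Factors may thus come from the
  unitary algebra, in particular be empty products.\<close>

lemma T2_ideal_mult:
  assumes J: "T2_ideal J" and f: "f \<in> J"
  shows "f * g \<in> J" "g * f \<in> J"
proof -
  obtain c where c: "g - fscale c 1 \<in> FYZ" using FYZ_minus_const by blast
  have s: "free.subspace J" using J by (simp add: T2_ideal_def)
  have "f * (g - fscale c 1) \<in> J" "(g - fscale c 1) * f \<in> J"
    using J f c by (auto simp: T2_ideal_def)
  then have "f * (g - fscale c 1) + fscale c f \<in> J" "(g - fscale c 1) * f + fscale c f \<in> J"
    using s f by (auto intro: free.subspace_add free.subspace_scale)
  then show "f * g \<in> J" "g * f \<in> J"
    by (simp_all add: algebra_simps fscale_mult_left fscale_mult_right)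
qed

subsection \<open>Substitution\<close>

definition subst :: "(var \<Rightarrow> 'a::field fpoly) \<Rightarrow> 'a fpoly \<Rightarrow> 'a fpoly" where
  "subst \<sigma> f = (\<Sum>w\<in>Poly_Mapping.keys f. fscale (Poly_Mapping.lookup f w) (prod_list (map \<sigma> w)))"

lemma subst_superset:
  assumes "finite A" "Poly_Mapping.keys f \<subseteq> A"
  shows "subst \<sigma> f = (\<Sum>w\<in>A. fscale (Poly_Mapping.lookup f w) (prod_list (map \<sigma> w)))"
  unfolding subst_def using assms
  by (intro sum.mono_neutral_left) (auto simp: in_keys_iff)

lemma subst_add: "subst \<sigma> (f + g) = subst \<sigma> f + subst \<sigma> g"
proof -
  let ?A = "Poly_Mapping.keys f \<union> Poly_Mapping.keys g"
  have "Poly_Mapping.keys (f + g) \<subseteq> ?A" by (rule keys_add)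
  then show ?thesis
    by (simp add: subst_superset[of ?A] lookup_add free.scale_left_distrib sum.distrib)
qed

lemma subst_fscale: "subst \<sigma> (fscale c f) = fscale c (subst \<sigma> f)"
proof -
  have "Poly_Mapping.keys (fscale c f) \<subseteq> Poly_Mapping.keys f" by (auto simp: in_keys_iff)
  then show ?thesis
    by (simp add: subst_superset[of "Poly_Mapping.keys f"] free.scale_sum_right)
qed

lemma subst_zero [simp]: "subst \<sigma> 0 = 0"
  by (simp add: subst_def)

lemma subst_monomial: "subst \<sigma> (monomial w) = prod_list (map \<sigma> w)"
  by (simp add: subst_def monomial_def)

lemma subst_diff: "subst \<sigma> (f - g) = subst \<sigma> f - subst \<sigma> g"
  using subst_add[of \<sigma> "f - g" g] by simp

lemma subst_mult: "subst \<sigma> (f * g) = subst \<sigma> f * subst \<sigma> g"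
proof -
  have mono: "subst \<sigma> (monomial u * g) = subst \<sigma> (monomial u) * subst \<sigma> g" for u
  proof -
    have "g \<in> free.span (range monomial)" by (simp add: span_all_monomials)
    then show ?thesis
      by (induction rule: free.span_induct_alt)
         (auto simp: distrib_left subst_add subst_fscale fscale_mult_right monomial_mult subst_monomial)
  qed
  have "f \<in> free.span (range monomial)" by (simp add: span_all_monomials)
  then show ?thesis
    by (induction rule: free.span_induct_alt)
       (auto simp: distrib_right subst_add subst_fscale fscale_mult_left mono)
qed

lemma subst_power: "subst \<sigma> (f ^ n) = subst \<sigma> f ^ n"
  by (induction n) (simp_all add: subst_mult monomial_Nil[symmetric] subst_monomial)

lemma subst_var [simp]: "subst \<sigma> (yvar i) = \<sigma> (Y i)" "subst \<sigma> (zvar i) = \<sigma> (Z i)"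
  by (simp_all add: yvar_def zvar_def subst_monomial)

lemma subst_comm: "subst \<sigma> (comm f g) = comm (subst \<sigma> f) (subst \<sigma> g)"
  by (simp add: comm_def subst_diff subst_mult)

text \<open>Freeness supplies superendomorphisms: the parity of the image of a word is the number of
  its odd factors modulo 2, which is unchanged when each variable goes to an element of its own
  parity.\<close>

lemma super_endo_subst:
  assumes Y: "\<And>i. \<sigma> (Y i) \<in> F_even" and Z: "\<And>i. \<sigma> (Z i) \<in> F_odd"
  shows "super_endo (subst \<sigma>)"
proof -
  have word: "(even (z_degree w) \<longrightarrow> prod_list (map \<sigma> w) \<in> F_even) \<and>
        (odd (z_degree w) \<longrightarrow> prod_list (map \<sigma> w) \<in> F_odd)" if "w \<noteq> []" for w
    using that
  proof (induction w)
    case (Cons v w)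
    have "\<sigma> v \<in> F_even \<and> (\<exists>i. v = Y i) \<or> \<sigma> v \<in> F_odd \<and> (\<exists>i. v = Z i)"
      using Y Z by (cases v) auto
    then show ?case
      using Cons by (cases "w = []")
        (auto intro: F_even_mult F_odd_mult F_even_odd_mult F_odd_even_mult)
  qed simp
  have lin: "subst \<sigma> f \<in> V" if f: "f \<in> free.span {monomial w |w. P w}" and V: "free.subspace V"
    and "\<And>w. P w \<Longrightarrow> prod_list (map \<sigma> w) \<in> V" for f P V
    using f by (induction rule: free.span_induct_alt)
      (auto simp: subst_add subst_fscale subst_monomial free.subspace_0[OF V] that(3)
        intro!: free.subspace_add[OF V] free.subspace_scale[OF V])
  have "subst \<sigma> f \<in> F_even" if "f \<in> F_even" for f
    using that[unfolded F_even_def] subspace_F_even by (rule lin) (use word in auto)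
  moreover have "subst \<sigma> f \<in> F_odd" if "f \<in> F_odd" for f
    using that[unfolded F_odd_def] subspace_F_odd by (rule lin) (use word in auto)
  moreover have "subst \<sigma> f \<in> FYZ" if "f \<in> FYZ" for f
    using that[unfolded FYZ_def] subspace_FYZ
    by (rule lin) (use word F_even_subset_FYZ F_odd_subset_FYZ in blast)
  ultimately show ?thesis
    unfolding super_endo_def by (auto simp: subst_add subst_fscale subst_mult)
qed

section \<open>The basis, indexed by multisets\<close>

abbreviation word_of :: "nat multiset \<Rightarrow> nat list" where
  "word_of \<equiv> sorted_list_of_multiset"

definition yword :: "nat list \<Rightarrow> 'a::field fpoly" where
  "yword w = monomial (map Y w)"

definition ad_word :: "nat list \<Rightarrow> 'a::field fpoly \<Rightarrow> 'a fpoly" where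
  "ad_word w t = foldl (\<lambda>u i. comm u (yvar i)) t w"

lemma yword_simps [simp]: "yword [] = 1" "yword (i # w) = yvar i * yword w"
    "yword (u @ v) = yword u * yword v"
  by (simp_all add: yword_def monomial_Nil monomial_mult yvar_def)

lemma ad_word_simps [simp]: "ad_word [] t = t" "ad_word (i # w) t = ad_word w (comm t (yvar i))"
    "ad_word (u @ v) t = ad_word v (ad_word u t)"
  by (simp_all add: ad_word_def)

section \<open>Exponent lists, reduced multisets and the words they stand for\<close>

definition reduced :: "nat \<Rightarrow> nat multiset \<Rightarrow> bool" where
  "reduced q M \<longleftrightarrow> (\<forall>i. count M i < q)"

definition expand :: "(nat \<times> nat) list \<Rightarrow> nat list" where
  "expand js = concat (map (\<lambda>(j, s). replicate s j) js)"

lemma expand_simps [simp]: "expand [] = []" "expand ((j, s) # js) = replicate s j @ expand js"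
  by (simp_all add: expand_def)

lemma yword_replicate: "yword (replicate n i) = yvar i ^ n"
  by (induction n) simp_all

lemma funpow_comm: "((\<lambda>x. comm x (yvar j)) ^^ s) u = ad_word (replicate s j) u"
  by (induction s arbitrary: u) (simp_all add: funpow_Suc_right del: funpow.simps(2))

lemma lcomm_ypow: "lcomm u (ypow js) = ad_word (expand js) u"
  unfolding lcomm_def by (induction js arbitrary: u) (auto simp: funpow_comm)

lemma lcomm_Cons: "lcomm u ((yvar j, s) # vs) = lcomm (ad_word (replicate s j) u) vs"
  by (simp add: lcomm_def funpow_comm)

lemma set_expand: "set (expand js) \<subseteq> fst ` set js"
  by (induction js) auto

lemma sorted_expand:
  assumes "sorted_wrt (<) (map fst js)"
  shows "sorted (expand js)"
  using assms
proof (induction js)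
  case (Cons p js)
  obtain j s where p: "p = (j, s)" by force
  have "\<forall>x\<in>set (expand js). j \<le> x"
    using set_expand[of js] Cons.prems p by fastforce
  with Cons show ?case by (auto simp: p sorted_append)
qed simp

lemma expand_eq_word_of:
  assumes "sorted_wrt (<) (map fst js)"
  shows "expand js = word_of (mset (expand js))"
  using sorted_expand[OF assms] by (simp add: sorted_sort_id)

lemma count_expand:
  assumes "distinct (map fst js)"
  shows "count (mset (expand js)) i = (if i \<in> fst ` set js then THE s. (i, s) \<in> set js else 0)"
  using assms
proof (induction js)
  case (Cons p js)
  obtain j s where p: "p = (j, s)" by force
  have nin: "j \<notin> fst ` set js" using Cons.prems p by auto
  then have "j \<notin> set (expand js)" using set_expand[of js] by auto
  then have 0: "count (mset (expand js)) j = 0" by (simp add: not_in_iff)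
  show ?case
  proof (cases "i = j")
    case True
    then have "(THE s'. (i, s') \<in> set (p # js)) = s"
      by (intro the_equality) (use nin p in \<open>auto simp: rev_image_eqI\<close>)
    with True 0 show ?thesis by (simp add: p)
  next
    case False
    then show ?thesis using Cons by (auto simp: p)
  qed
qed simp

lemma reduced_expand:
  assumes "sorted_wrt (<) (map fst js)" "\<forall>(j, s)\<in>set js. s < q" "q > 0"
  shows "reduced q (mset (expand js))"
proof -
  have d: "distinct (map fst js)" using assms(1) by (simp add: strict_sorted_iff)
  have "(THE s. (i, s) \<in> set js) < q" if i: "i \<in> fst ` set js" for i
  proof -
    obtain s where s: "(i, s) \<in> set js" using i by auto
    have "(THE s. (i, s) \<in> set js) = s"
      using d s by (intro the_equality) (auto dest: eq_key_imp_eq_value)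
    with s assms(2) show ?thesis by auto
  qed
  then show ?thesis unfolding reduced_def count_expand[OF d] using assms(3) by auto
qed

lemma expand_count:
  assumes "sorted_wrt (<) ns" "set_mset M \<subseteq> set ns"
  shows "expand (map (\<lambda>i. (i, count M i)) ns) = word_of M"
proof -
  let ?js = "map (\<lambda>i. (i, count M i)) ns"
  have f: "map fst ?js = ns" by (simp add: o_def)
  have d: "distinct (map fst ?js)" unfolding f using assms(1) by (simp add: strict_sorted_iff)
  have "mset (expand ?js) = M"
  proof (rule multiset_eqI)
    fix i
    show "count (mset (expand ?js)) i = count M i"
      unfolding count_expand[OF d] using assms(2) by (auto simp: image_image not_in_iff image_iff)
  qed
  moreover have "sorted_wrt (<) (map fst ?js)" unfolding f by (rule assms(1))
  ultimately show ?thesis using expand_eq_word_of by metis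
qed

lemma prod_list_yvar_powers:
  "prod_list (map (\<lambda>i. yvar i ^ r i) ns) = yword (expand (map (\<lambda>i. (i, r i)) ns))"
  by (induction ns) (simp_all add: yword_replicate)

text \<open>\<open>Comm j m M\<close> is form (i), where \<open>M\<close> collects all indices \<open>j\<^sub>1, \<dots>, j\<^sub>n\<close> with multiplicities
  \<open>s\<^sub>1, \<dots>, s\<^sub>n\<close>, including \<open>j = j\<^sub>1\<close> and \<open>m = j\<^sub>2\<close>; \<open>Power l M\<close> is form (ii), where \<open>M\<close> omits \<open>l = l\<^sub>1\<close>.\<close>

datatype comm_index = Comm nat nat "nat multiset" | Power nat "nat multiset"

fun comm_poly :: "nat \<Rightarrow> comm_index \<Rightarrow> 'a::field fpoly" where
  "comm_poly q (Comm j m M) = ad_word (replicate (count M m) m @ replicate (count M j - 1) j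
     @ word_of (filter_mset (\<lambda>i. i \<noteq> j \<and> i \<noteq> m) M)) (yvar j)"
| "comm_poly q (Power l M) = ad_word (word_of M) (yvar l ^ q - yvar l)"

fun valid_comm :: "nat \<Rightarrow> comm_index \<Rightarrow> bool" where
  "valid_comm q (Comm j m M) \<longleftrightarrow>
     m < j \<and> m \<in># M \<and> j \<in># M \<and> (\<forall>i\<in>#M. m \<le> i) \<and> reduced q M"
| "valid_comm q (Power l M) \<longleftrightarrow> l \<notin># M \<and> reduced q M"

lemma ordered_q_commutator_imp_comm_poly:
  assumes "ordered_q_commutator q p" "q > 0"
  shows "\<exists>c. valid_comm q c \<and> p = comm_poly q c"
  using assms(1)
proof cases
  case (form1 j1 j2 js s1 s2)
  \<comment> \<open>The letter \<open>j1\<close> enters \<open>s1\<close> times: once as the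
    innermost entry and \<open>s1 - 1\<close> times as a later one.\<close>
  define M where "M = mset (replicate s2 j2 @ replicate s1 j1 @ expand js)"
  have srt: "sorted_wrt (<) (map fst js)" using form1 by simp
  have nin: "j1 \<notin> set (expand js)" "j2 \<notin> set (expand js)" and j12: "j1 \<noteq> j2"
    using set_expand[of js] form1(2) by auto
  have ge: "\<forall>i\<in>set (expand js). j2 < i"
    using set_expand[of js] form1(4) by auto
  have cnt: "count (mset (expand js)) j1 = 0" "count (mset (expand js)) j2 = 0"
    using nin by (metis not_in_iff set_mset_mset)+
  have "reduced q (mset (expand js))"
    using srt form1 by (intro reduced_expand assms(2)) auto
  then have red: "reduced q M"
    using form1(6,8) j12 unfolding reduced_def
    by (metis M_def cnt count_replicate_mset mset_append mset_replicate count_union add.left_neutral add.right_neutral)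
  have "filter (\<lambda>i. i \<noteq> j1 \<and> i \<noteq> j2) (replicate s2 j2 @ replicate s1 j1 @ expand js) = expand js"
    using nin by (auto simp: filter_id_conv)
  then have filt: "filter_mset (\<lambda>i. i \<noteq> j1 \<and> i \<noteq> j2) M = mset (expand js)"
    unfolding M_def by (simp only: mset_filter[symmetric])
  have counts: "count M j1 = s1" "count M j2 = s2"
    using cnt j12 by (auto simp: M_def)
  have p: "p = comm_poly q (Comm j1 j2 M)"
    using expand_eq_word_of[OF srt]
    by (simp add: form1(1) lcomm_Cons lcomm_ypow filt counts)
  moreover have "valid_comm q (Comm j1 j2 M)"
    using red form1 ge by (auto simp: M_def)
  ultimately show ?thesis by blast
next
  case (form2 l ls)
  have "l \<notin> set (expand ls)" using set_expand[of ls] form2(2) by auto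
  then have "valid_comm q (Power l (mset (expand ls)))"
    using form2 reduced_expand[of ls q] assms(2) by simp
  moreover have "p = comm_poly q (Power l (mset (expand ls)))"
    using expand_eq_word_of[OF form2(3)] by (simp add: form2(1) lcomm_ypow)
  ultimately show ?thesis by blast
qed

lemma ordered_q_commutator_comm_poly:
  assumes "valid_comm q c"
  shows "ordered_q_commutator q (comm_poly q c)"
proof (cases c)
  case (Comm j m M)
  let ?M = "filter_mset (\<lambda>i. i \<noteq> j \<and> i \<noteq> m) M"
  let ?ns = "sorted_list_of_set (set_mset ?M)"
  let ?js = "map (\<lambda>i. (i, count ?M i)) ?ns"
  have f: "map fst ?js = ?ns" by (simp add: o_def)
  have "ordered_q_commutator q
     (lcomm (yvar j) ((yvar m, count M m) # (yvar j, count M j - 1) # ypow ?js))"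
  proof (rule form1)
    have v: "m < j" "m \<in># M" "j \<in># M" "\<forall>i\<in>#M. m \<le> i" "\<forall>i. count M i < q"
      using assms by (auto simp: Comm reduced_def)
    then show "m < j" "1 \<le> count M j" "count M j < q" "1 \<le> count M m" "count M m < q"
      by (auto simp: Suc_le_eq)
    show "distinct (j # m # map fst ?js)" "sorted_wrt (<) (m # map fst ?js)"
      unfolding f using v by (auto simp: le_neq_implies_less)
    show "\<forall>(i, s)\<in>set ?js. 1 \<le> s \<and> s < q"
      using v(5) by (auto simp: Suc_le_eq)
  qed
  moreover have "expand ?js = word_of ?M" by (rule expand_count) auto
  ultimately show ?thesis unfolding Comm
    by (simp add: lcomm_Cons lcomm_ypow del: map_map)
next
  case (Power l M)
  let ?ns = "sorted_list_of_set (set_mset M)"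
  let ?js = "map (\<lambda>i. (i, count M i)) ?ns"
  have f: "map fst ?js = ?ns" by (simp add: o_def)
  have "ordered_q_commutator q (lcomm (yvar l ^ q - yvar l) (ypow ?js))"
    using assms unfolding Power
    by (intro form2) (auto simp: f reduced_def simp del: map_map)
  moreover have "expand ?js = word_of M" by (rule expand_count) auto
  ultimately show ?thesis unfolding Power by (simp add: lcomm_ypow del: map_map)
qed

type_synonym basis_index = "nat multiset \<times> (nat \<times> nat multiset) option \<times> comm_index option"

fun z_factor :: "(nat \<times> nat multiset) option \<Rightarrow> 'a::field fpoly" where
  "z_factor None = 1"
| "z_factor (Some (j, M)) = ad_word (word_of M) (zvar j)"

fun comm_factor :: "nat \<Rightarrow> comm_index option \<Rightarrow> 'a::field fpoly" where
  "comm_factor q None = 1"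
| "comm_factor q (Some c) = comm_poly q c"

fun basis_poly :: "nat \<Rightarrow> basis_index \<Rightarrow> 'a::field fpoly" where
  "basis_poly q (R, zo, co) = yword (word_of R) * z_factor zo * comm_factor q co"

definition basis_indices :: "nat \<Rightarrow> basis_index set" where
  "basis_indices q = {(R, zo, co). reduced q R \<and> (\<forall>j M. zo = Some (j, M) \<longrightarrow> reduced q M)
     \<and> (\<forall>c. co = Some c \<longrightarrow> valid_comm q c) \<and> (R \<noteq> {#} \<or> zo \<noteq> None \<or> co \<noteq> None)}"

text \<open>Zero exponents and trailing indices change the parameters of a basis polynomial but not
  its multiset, so the index set is free of this redundancy.\<close>

lemma basis_polys_eq_image:
  assumes q: "q > 0"
  shows "(basis_polys q :: 'a::field fpoly set) = basis_poly q ` basis_indices q"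
proof
  show "(basis_polys q :: 'a fpoly set) \<subseteq> basis_poly q ` basis_indices q"
  proof
    fix f :: "'a fpoly" assume "f \<in> basis_polys q"
    then obtain m r j js p \<theta>1 \<theta>2 where f: "f = prod_list (map (\<lambda>i. yvar i ^ r i) [0..<m])
          * lcomm (zvar j) (ypow js) ^ \<theta>1 * p ^ \<theta>2"
      and r: "\<forall>i<m. r i < q" and js: "sorted_wrt (<) (map fst js)" "\<forall>(k, s)\<in>set js. s < q"
      and p: "ordered_q_commutator q p" and th: "\<theta>1 \<in> {0, 1}" "\<theta>2 \<in> {0, 1}"
      and pos: "(\<Sum>i<m. r i) + \<theta>1 + \<theta>2 \<ge> 1"
      unfolding basis_polys_def by blast
    obtain c where c: "valid_comm q c" "p = comm_poly q c"
      using ordered_q_commutator_imp_comm_poly[OF p q] by blast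
    let ?rs = "map (\<lambda>i. (i, r i)) [0..<m]"
    define R where "R = mset (expand ?rs)"
    have srt: "sorted_wrt (<) (map fst ?rs)" by (simp add: o_def)
    have R: "reduced q R" unfolding R_def by (rule reduced_expand[OF srt _ q]) (use r in auto)
    define zo where "zo = (if \<theta>1 = 0 then None else Some (j, mset (expand js)))"
    define co where "co = (if \<theta>2 = 0 then None else Some c)"
    have "length (expand ?rs) = (\<Sum>i<m. r i)"
      by (simp add: expand_def length_concat o_def interv_sum_list_conv_sum_set_nat lessThan_atLeast0)
    then have "size R = (\<Sum>i<m. r i)" by (simp add: R_def)
    then have ne: "R \<noteq> {#} \<or> zo \<noteq> None \<or> co \<noteq> None"
      using pos th unfolding zo_def co_def by (cases "\<theta>1 = 0"; cases "\<theta>2 = 0") auto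
    have "(R, zo, co) \<in> basis_indices q"
      using R ne c reduced_expand[OF js q] by (auto simp: basis_indices_def zo_def co_def)
    moreover have "f = basis_poly q (R, zo, co)"
      using th c expand_eq_word_of[OF srt] expand_eq_word_of[OF js(1)]
      by (auto simp: f prod_list_yvar_powers lcomm_ypow zo_def co_def R_def simp del: sorted_list_of_multiset_mset)
    ultimately show "f \<in> basis_poly q ` basis_indices q" by blast
  qed
  show "basis_poly q ` basis_indices q \<subseteq> (basis_polys q :: 'a fpoly set)"
  proof (clarify)
    fix R zo co assume a: "(R, zo, co) \<in> basis_indices q"
    obtain m where m: "set_mset R \<subseteq> {..<m}"
      by (metis finite_nat_iff_bounded finite_set_mset)
    obtain j M where jM: "zo \<noteq> None \<Longrightarrow> zo = Some (j, M)" by (cases zo) auto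
    \<comment> \<open>Even with exponent 0 the factor \<open>p\<close> must be some ordered
      commutator; \<open>Power 0 {#}\<close>, the polynomial \<open>y^q - y\<close> in the first
      variable, fills the gap.\<close>
    obtain c where c: "co \<noteq> None \<Longrightarrow> co = Some c" "co = None \<Longrightarrow> c = Power 0 {#}"
      by (cases co) auto
    let ?js = "map (\<lambda>i. (i, count M i)) (sorted_list_of_set (set_mset M))"
    define \<theta>1 \<theta>2 :: nat where "\<theta>1 = (if zo = None then 0 else 1)" and "\<theta>2 = (if co = None then 0 else 1)"
    define js where "js = (if zo = None then [] else ?js)"
    have js: "sorted_wrt (<) (map fst js)" "\<forall>(k, s)\<in>set js. s < q"
      using a jM by (auto simp: js_def o_def basis_indices_def reduced_def)
    have lz: "lcomm (zvar j) (ypow js) ^ \<theta>1 = (z_factor zo :: 'a fpoly)"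
    proof (cases "zo = None")
      case False
      have "expand ?js = word_of M" by (rule expand_count) auto
      then show ?thesis using jM[OF False] by (simp add: \<theta>1_def js_def lcomm_ypow del: map_map)
    qed (simp add: \<theta>1_def)
    have vc: "valid_comm q c" using a c q by (cases co) (auto simp: basis_indices_def reduced_def)
    have lc: "comm_poly q c ^ \<theta>2 = (comm_factor q co :: 'a fpoly)"
      using c by (cases co) (auto simp: \<theta>2_def)
    have ex: "expand (map (\<lambda>i. (i, count R i)) [0..<m]) = word_of R"
      by (rule expand_count) (use m in auto)
    have "basis_poly q (R, zo, co) = prod_list (map (\<lambda>i. yvar i ^ count R i) [0..<m])
        * lcomm (zvar j) (ypow js) ^ \<theta>1 * (comm_poly q c :: 'a fpoly) ^ \<theta>2"
      unfolding lz lc prod_list_yvar_powers ex by simp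
    moreover have "(\<Sum>i<m. count R i) + \<theta>1 + \<theta>2 \<ge> 1"
    proof -
      have "size R = (\<Sum>i<m. count R i)"
        unfolding size_multiset_overloaded_eq
        by (rule sum.mono_neutral_left) (use m in \<open>auto simp: not_in_iff\<close>)
      moreover have "R \<noteq> {#} \<or> zo \<noteq> None \<or> co \<noteq> None" using a by (auto simp: basis_indices_def)
      ultimately show ?thesis by (cases "R = {#}") (auto simp: \<theta>1_def \<theta>2_def Suc_le_eq nonempty_has_size)
    qed
    moreover have "\<forall>i<m. count R i < q" using a by (auto simp: basis_indices_def reduced_def)
    moreover have "\<theta>1 \<in> {0, 1}" "\<theta>2 \<in> {0, 1}" by (auto simp: \<theta>1_def \<theta>2_def)
    ultimately show "basis_poly q (R, zo, co) \<in> (basis_polys q :: 'a fpoly set)"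
      using js ordered_q_commutator_comm_poly[OF vc] unfolding basis_polys_def by blast
  qed
qed

section \<open>Iterated commutators with \<open>q\<close> entries\<close>

lemma finite_field_power_card:
  fixes x :: "'a::{field, finite}"
  shows "x ^ CARD('a) = x"
proof (cases "x = 0")
  case False
  let ?U = "UNIV - {0 :: 'a}"
  have "bij_betw ((*) x) ?U ?U"
    by (rule bij_betw_byWitness[of _ "(*) (inverse x)"]) (use False in auto)
  then have "\<Prod>?U = (\<Prod>y\<in>?U. x * y)"
    using prod.reindex_bij_betw[of "(*) x" ?U ?U "\<lambda>y. y"] by simp
  also have "\<dots> = x ^ card ?U * \<Prod>?U" by (simp add: prod.distrib)
  finally have "x ^ card ?U = 1" by simp
  moreover have "CARD('a) = Suc (card ?U)"
    by (rule card.remove) auto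
  ultimately show ?thesis by (simp only: power_Suc mult_1_right)
qed (simp add: power_0_left)

lemma CARD_field_ge_2: "CARD('a::{field, finite}) \<ge> 2"
proof -
  have "card {0, 1 :: 'a} \<le> CARD('a)" by (rule card_mono) auto
  then show ?thesis by simp
qed

text \<open>A nonzero polynomial with all \<open>q\<close> field elements as roots has degree at
  least \<open>q\<close>.\<close>

lemma poly_eq_0_finite_field:
  fixes p :: "'a::{field, finite} poly"
  assumes "\<And>x. poly p x = 0" "\<And>k. k \<ge> CARD('a) \<Longrightarrow> coeff p k = 0"
  shows "p = 0"
proof (rule ccontr)
  assume "p \<noteq> 0"
  then have "CARD('a) \<le> degree p" using card_poly_roots_bound[of p] assms(1) by simp
  then have "lead_coeff p = 0" by (rule assms(2))
  with \<open>p \<noteq> 0\<close> show False by simp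
qed

text \<open>Both sides are monic of degree \<open>q\<close> and take the value \<open>x - 1\<close>
  at every field element \<open>x\<close>, so their difference has degree below \<open>q\<close> and
  vanishes everywhere.\<close>

lemma X_minus_1_power_card:
  "[:-1, 1:] ^ CARD('a) = (monom 1 CARD('a) - 1 :: 'a::{field, finite} poly)"
proof -
  let ?q = "CARD('a)"
  let ?d = "[:-1, 1:] ^ ?q - (monom 1 ?q - 1) :: 'a poly"
  have deg: "degree ([:-1, 1 :: 'a:] ^ ?q) = ?q" by (simp add: degree_power_eq)
  have lead: "coeff ([:-1, 1 :: 'a:] ^ ?q) ?q = 1"
    using lead_coeff_power[of "[:-1, 1 :: 'a:]" ?q] by (simp add: deg)
  have "?d = 0"
  proof (rule poly_eq_0_finite_field)
    show "poly ?d x = 0" for x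
      by (simp add: poly_power poly_monom finite_field_power_card)
    show "coeff ?d k = 0" if "k \<ge> ?q" for k
    proof (cases "k = ?q")
      case True
      then show ?thesis using lead by (simp add: coeff_monom)
    next
      case False
      with that have "k > ?q" by simp
      moreover from this have "coeff ([:-1, 1 :: 'a:] ^ ?q) k = 0" by (intro coeff_eq_0) (simp add: deg)
      ultimately show ?thesis using CARD_field_ge_2[where 'a='a] by (simp add: coeff_monom)
    qed
  qed
  then show ?thesis by simp
qed

text \<open>Left and right multiplication by \<open>y\<close> commute, so the coefficients are those of \<open>(X - 1)^n\<close>.\<close>

lemma ad_word_replicate:
  "ad_word (replicate n i) t
     = (\<Sum>k\<le>n. fscale (coeff ([:-1, 1:] ^ n) k) (yvar i ^ (n - k) * t * yvar i ^ k))"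
proof (induction n)
  case (Suc n)
  let ?y = "yvar i" and ?p = "[:-1, 1:] ^ n :: 'a poly"
  have cf: "coeff ([:-1, 1:] ^ Suc n) k = (case k of 0 \<Rightarrow> 0 | Suc l \<Rightarrow> coeff ?p l) - coeff ?p k" for k
    by (cases k) (simp_all add: mult_pCons_left coeff_pCons)
  have top: "coeff ?p (Suc n) = 0"
    by (rule coeff_eq_0) (simp add: degree_power_eq)
  have "ad_word (replicate (Suc n) i) t = comm (ad_word (replicate n i) t) ?y"
  proof -
    have "replicate (Suc n) i = replicate n i @ [i]" by (simp add: replicate_append_same)
    then show ?thesis by (simp only: ad_word_simps)
  qed
  also have "\<dots> = (\<Sum>k\<le>n. fscale (coeff ?p k) (?y ^ (n - k) * t * ?y ^ Suc k))
      - (\<Sum>k\<le>n. fscale (coeff ?p k) (?y ^ (Suc n - k) * t * ?y ^ k))"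
    unfolding Suc comm_def sum_distrib_left sum_distrib_right
    by (intro arg_cong2[where f="(-)"] sum.cong)
       (auto simp: fscale_mult_left fscale_mult_right mult.assoc power_commutes Suc_diff_le)
  also have "(\<Sum>k\<le>n. fscale (coeff ?p k) (?y ^ (n - k) * t * ?y ^ Suc k))
      = (\<Sum>k\<le>Suc n. fscale (case k of 0 \<Rightarrow> 0 | Suc l \<Rightarrow> coeff ?p l) (?y ^ (Suc n - k) * t * ?y ^ k))"
    unfolding sum.atMost_Suc_shift by simp
  also have "(\<Sum>k\<le>n. fscale (coeff ?p k) (?y ^ (Suc n - k) * t * ?y ^ k))
      = (\<Sum>k\<le>Suc n. fscale (coeff ?p k) (?y ^ (Suc n - k) * t * ?y ^ k))"
    using top by simp
  finally show ?case
    unfolding cf free.scale_left_diff_distrib sum_subtractf .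
qed simp

text \<open>Only the coefficients -1 and 1 of \<open>X^q - 1\<close> survive in the
  expansion.\<close>

lemma ad_word_replicate_card:
  "ad_word (replicate CARD('a) i) (t :: 'a::{field, finite} fpoly) = comm t (yvar i ^ CARD('a))"
proof -
  let ?q = "CARD('a)"
  have "ad_word (replicate ?q i) t
     = (\<Sum>k\<in>{0, ?q}. fscale (coeff ([:-1, 1:] ^ ?q) k) (yvar i ^ (?q - k) * t * yvar i ^ k))"
    unfolding ad_word_replicate X_minus_1_power_card
    by (rule sum.mono_neutral_right) (auto simp: coeff_monom)
  also have "\<dots> = comm t (yvar i ^ ?q)"
    unfolding X_minus_1_power_card by (simp add: comm_def coeff_monom free.scale_minus_left)
  finally show ?thesis .
qed

section \<open>Reordering words\<close>

lemma subspace_congruence_trans: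
  assumes "free.subspace K" "f - g \<in> K" "g - h \<in> K"
  shows "f - h \<in> K"
  using free.subspace_add[OF assms] by simp

text \<open>Insertion sort uses adjacent swaps only, and words with the same letters have the same
  sorted form. The prefix \<open>u\<close> stays arbitrary because the induction descends into the
  tail. A general \<open>f\<close> lets the argument serve both for products of variables and for
  iterated commutators.\<close>

lemma word_permutation:
  fixes f :: "nat list \<Rightarrow> 'a::field fpoly"
  assumes K: "free.subspace K"
    and swap: "\<And>u i k v. f (u @ i # k # v) - f (u @ k # i # v) \<in> K"
    and w: "mset w = mset w'"
  shows "f w - f w' \<in> K"
proof -
  note trans = subspace_congruence_trans[OF K]
  have insort: "f (u @ i # v) - f (u @ insort i v) \<in> K" for u i v
  proof (induction v arbitrary: u)
    case (Cons k v)
    have "f (u @ k # i # v) - f (u @ k # insort i v) \<in> K"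
      using Cons[of "u @ [k]"] by simp
    then have "f (u @ i # k # v) - f (u @ k # insort i v) \<in> K"
      by (rule trans[OF swap])
    then show ?case by (simp add: free.subspace_0[OF K])
  qed (simp add: free.subspace_0[OF K])
  have sort: "f (u @ v) - f (u @ sort v) \<in> K" for u v
  proof (induction v arbitrary: u)
    case (Cons i v)
    have "f (u @ i # v) - f (u @ i # sort v) \<in> K" using Cons[of "u @ [i]"] by simp
    then show ?case using insort by (auto intro: trans)
  qed (simp add: free.subspace_0[OF K])
  have "sort w = sort w'" using arg_cong[OF w, of word_of] by simp
  then have "f w' - f (sort w) \<in> K" using sort[of "[]" w'] by simp
  from free.subspace_neg[OF K this] have "f (sort w) - f w' \<in> K" by simp
  with sort[of "[]" w] show ?thesis by (auto intro: trans)
qed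

lemma mset_replicate_split:
  fixes w :: "nat list"
  shows "n \<le> count (mset w) i \<Longrightarrow> \<exists>w'. mset w = mset (replicate n i @ w')"
  by (rule exI[of _ "word_of (mset w - replicate_mset n i)"])
     (simp add: count_le_replicate_mset_subset_eq)

text \<open>A letter occurring \<open>q\<close> times is moved to the front, where \<open>q\<close>
  copies collapse to one. One copy always remains, so a nonempty word never reduces to the empty
  one; this keeps the reduction inside the non-unitary algebra.\<close>

lemma word_reduction:
  fixes f :: "nat list \<Rightarrow> 'a::field fpoly"
  assumes K: "free.subspace K" and q: "q \<ge> 2"
    and swap: "\<And>u i k v. f (u @ i # k # v) - f (u @ k # i # v) \<in> K"
    and pow: "\<And>i v. f (replicate q i @ v) - f (i # v) \<in> K"
  shows "\<exists>M. reduced q M \<and> (w \<noteq> [] \<longrightarrow> M \<noteq> {#}) \<and> f w - f (word_of M) \<in> K"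
proof (induction "length w" arbitrary: w rule: less_induct)
  case less
  note perm = word_permutation[where f=f, OF K swap]
  show ?case
  proof (cases "reduced q (mset w)")
    case True
    then show ?thesis by (intro exI[of _ "mset w"] conjI perm) auto
  next
    case False
    then obtain i where "q \<le> count (mset w) i" by (auto simp: reduced_def not_less)
    then obtain w' where w': "mset w = mset (replicate q i @ w')" using mset_replicate_split by blast
    have "f w - f (i # w') \<in> K"
      using perm[OF w'] pow subspace_congruence_trans[OF K] by blast
    moreover have "length (i # w') < length w" using arg_cong[OF w', of size] q by simp
    ultimately show ?thesis using less[of "i # w'"] subspace_congruence_trans[OF K] by blast
  qed
qed

lemma ad_word_0 [simp]: "ad_word w 0 = 0"
  by (induction w) (simp_all add: comm_def)

lemma ad_word_add: "ad_word w (f + g) = ad_word w f + ad_word w g"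
proof (induction w arbitrary: f g)
  case (Cons i w)
  have "comm (f + g) (yvar i) = comm f (yvar i) + comm g (yvar i)"
    by (simp add: comm_def algebra_simps)
  then show ?case using Cons by simp
qed simp

lemma ad_word_diff: "ad_word w (f - g) = ad_word w f - ad_word w g"
  using ad_word_add[of w "f - g" g] by simp

lemma ad_word_minus: "ad_word w (- f) = - ad_word w f"
  using ad_word_diff[of w 0 f] by simp

text \<open>Iterate \<open>t y = y t + [t, y]\<close>.\<close>

lemma mult_yword_expand:
  assumes "sorted w"
  shows "t * yword w \<in> free.span {yword u * ad_word w' t |u w'. sorted w' \<and> mset w' \<subseteq># mset w}"
  using assms
proof (induction w arbitrary: t)
  case Nil
  have "t * yword [] = yword [] * ad_word [] t" by simp
  then show ?case by (intro free.span_base) (use sorted_wrt.simps(1) in blast)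
next
  case (Cons i w)
  let ?S = "\<lambda>w t. {yword u * ad_word w' t |u w'. sorted w' \<and> mset w' \<subseteq># mset w}"
  have 1: "yvar i * g \<in> free.span (?S (i # w) t)" if "g \<in> free.span (?S w t)" for g
    using that
  proof (induction rule: free.span_induct_alt)
    case (step c x g)
    then obtain u w' where x: "x = yword u * ad_word w' t" "sorted w'" "mset w' \<subseteq># mset w" by blast
    have "yvar i * x = yword (i # u) * ad_word w' t" by (simp add: x mult.assoc)
    moreover have "mset w' \<subseteq># mset (i # w)" by (rule subset_mset.order_trans[OF x(3)]) simp
    ultimately have "yvar i * x \<in> ?S (i # w) t" using x(2) by blast
    then show ?case using step.IH
      by (simp add: distrib_left fscale_mult_right free.span_add free.span_scale free.span_base)
  qed (simp add: free.span_zero)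
  have "?S w (comm t (yvar i)) \<subseteq> ?S (i # w) t"
  proof clarify
    fix u w' assume w': "sorted w'" "mset w' \<subseteq># mset w"
    \<comment> \<open>The letter \<open>i\<close> is at most every later one, so the commutator
      entries stay sorted when it is put in front of them.\<close>
    then have "set w' \<subseteq> set w" by (metis set_mset_mono set_mset_mset)
    then have "sorted (i # w')" using w' Cons.prems by auto
    then show "\<exists>u' w''. yword u * ad_word w' (comm t (yvar i)) = yword u' * ad_word w'' t
        \<and> sorted w'' \<and> mset w'' \<subseteq># mset (i # w)"
      using w' by (intro exI[of _ u] exI[of _ "i # w'"]) simp
  qed
  then have 2: "comm t (yvar i) * yword w \<in> free.span (?S (i # w) t)"
    using Cons.IH[of "comm t (yvar i)"] Cons.prems free.span_mono by (auto simp del: ad_word_simps)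
  have "t * yword (i # w) = yvar i * (t * yword w) + comm t (yvar i) * yword w"
    by (simp add: comm_def algebra_simps)
  moreover have "yvar i * (t * yword w) \<in> free.span (?S (i # w) t)"
    using Cons.IH[of t] Cons.prems by (intro 1) auto
  ultimately show ?case using 2 by (simp only: free.span_add)
qed

section \<open>Evaluation in \<open>UT\<^sub>3\<close>\<close>

lemma poly_eval_monomial: "poly_eval \<sigma> (monomial w) = word_eval \<sigma> w"
  by (simp add: poly_eval_def monomial_def)

lemma word_eval_simps [simp]: "word_eval \<sigma> [] = mat 1" "word_eval \<sigma> (v # w) = \<sigma> v ** word_eval \<sigma> w"
  by (simp_all add: word_eval_def)

lemma word_eval_append: "word_eval \<sigma> (u @ v) = word_eval \<sigma> u ** word_eval \<sigma> v"
  by (induction u) (simp_all add: matrix_mul_assoc)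

lemma matrix_zero_mult: "0 ** A = 0" "A ** 0 = (0 :: 'a::semiring_1^'n^'m)"
  by (simp_all add: matrix_matrix_mult_def vec_eq_iff)

lemma matrix_add_mult: "(A + B) ** C = A ** C + B ** (C :: 'a::semiring_1^'n^'k)"
  by (simp add: matrix_matrix_mult_def vec_eq_iff distrib_right sum.distrib)

lemma mat_scale_mult:
  "mat_scale c A ** B = mat_scale c (A ** B)" "A ** mat_scale c B = mat_scale c (A ** B)"
  by (simp_all add: mat_scale_def matrix_matrix_mult_def vec_eq_iff sum_distrib_left mult_ac)

lemma poly_eval_zero [simp]: "poly_eval \<sigma> 0 = 0"
  by (simp add: poly_eval_def)

lemma poly_eval_one [simp]: "poly_eval \<sigma> 1 = mat 1"
  unfolding monomial_Nil[symmetric] by (simp add: poly_eval_monomial)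

lemma poly_eval_diff: "poly_eval \<sigma> (f - g) = poly_eval \<sigma> f - poly_eval \<sigma> g"
  using poly_eval_add[of \<sigma> "f - g" g] by simp

lemma poly_eval_mult: "poly_eval \<sigma> (f * g) = poly_eval \<sigma> f ** poly_eval \<sigma> g"
proof -
  have mono: "poly_eval \<sigma> (monomial u * g) = poly_eval \<sigma> (monomial u) ** poly_eval \<sigma> g" for u
  proof -
    have "g \<in> free.span (range monomial)" by (simp add: span_all_monomials)
    then show ?thesis
      by (induction rule: free.span_induct_alt)
         (auto simp: distrib_left poly_eval_add poly_eval_fscale fscale_mult_right monomial_mult
           poly_eval_monomial word_eval_append matrix_add_ldistrib mat_scale_mult matrix_zero_mult)
  qed
  have "f \<in> free.span (range monomial)" by (simp add: span_all_monomials)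
  then show ?thesis
    by (induction rule: free.span_induct_alt)
       (auto simp: distrib_right poly_eval_add poly_eval_fscale fscale_mult_left mono
         matrix_add_mult mat_scale_mult matrix_zero_mult)
qed

lemma poly_eval_comm: "poly_eval \<sigma> (comm f g) = poly_eval \<sigma> f ** poly_eval \<sigma> g - poly_eval \<sigma> g ** poly_eval \<sigma> f"
  by (simp add: comm_def poly_eval_diff poly_eval_mult)

lemma poly_eval_var [simp]: "poly_eval \<sigma> (yvar i) = \<sigma> (Y i)" "poly_eval \<sigma> (zvar i) = \<sigma> (Z i)"
  by (simp_all add: yvar_def zvar_def poly_eval_monomial)

lemma matrix_mult_entry_3: "(A ** B) $ i $ j = A$i$1 * B$1$j + A$i$2 * B$2$j + A$i$(3::3) * B$3$j"
  by (simp add: matrix_matrix_mult_def sum_3)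

lemma mat_3_eq_iff: "(A :: 'a^3^3) = B \<longleftrightarrow> (\<forall>i\<in>{1,2,3}. \<forall>j\<in>{1,2,3}. A$i$j = B$i$j)"
  by (auto simp: vec_eq_iff forall_3)

lemma UT3_even_iff:
  "A \<in> UT3_even \<longleftrightarrow> A$1$2 = 0 \<and> A$1$3 = 0 \<and> A$2$1 = 0 \<and> A$3$1 = 0 \<and> A$3$2 = 0" (is "?L \<longleftrightarrow> ?R A")
proof
  have "mats.subspace {A. ?R A}"
    by (rule mats.subspaceI) (auto simp: mat_scale_def)
  moreover have "{e_mat 1 1, e_mat 2 2, e_mat 3 3, e_mat 2 3} \<subseteq> {A. ?R A}" by (simp add: e_mat_def)
  ultimately show "?R A" if ?L
    using that mats.span_minimal unfolding UT3_even_def by blast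
  assume R: "?R A"
  have "A = mat_scale (A$1$1) (e_mat 1 1) + mat_scale (A$2$2) (e_mat 2 2) + mat_scale (A$3$3) (e_mat 3 3)
      + mat_scale (A$2$3) (e_mat 2 3)"
    using R by (simp add: mat_3_eq_iff mat_scale_def e_mat_def)
  also have "\<dots> \<in> UT3_even"
    unfolding UT3_even_def by (intro mats.span_add mats.span_scale mats.span_base) auto
  finally show ?L .
qed

lemma UT3_odd_iff:
  "A \<in> UT3_odd \<longleftrightarrow> A$1$1 = 0 \<and> (\<forall>j\<in>{1,2,3}. A$2$j = 0 \<and> A$3$j = 0)" (is "?L \<longleftrightarrow> ?R A")
proof
  have "mats.subspace {A. ?R A}"
    by (rule mats.subspaceI) (auto simp: mat_scale_def)
  moreover have "{e_mat 1 2, e_mat 1 3} \<subseteq> {A. ?R A}" by (simp add: e_mat_def)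
  ultimately show "?R A" if ?L
    using that mats.span_minimal unfolding UT3_odd_def by blast
  assume R: "?R A"
  have "A = mat_scale (A$1$2) (e_mat 1 2) + mat_scale (A$1$3) (e_mat 1 3)"
    using R by (simp add: mat_3_eq_iff mat_scale_def e_mat_def)
  also have "\<dots> \<in> UT3_odd"
    unfolding UT3_odd_def by (intro mats.span_add mats.span_scale mats.span_base) auto
  finally show ?L .
qed

lemma UT3_even_mult: "A \<in> UT3_even \<Longrightarrow> B \<in> UT3_even \<Longrightarrow> A ** B \<in> UT3_even"
  by (simp add: UT3_even_iff matrix_mult_entry_3)

lemma UT3_even_odd_mult: "A \<in> UT3_even \<Longrightarrow> B \<in> UT3_odd \<Longrightarrow> A ** B \<in> UT3_odd"
    and UT3_odd_even_mult: "B \<in> UT3_odd \<Longrightarrow> A \<in> UT3_even \<Longrightarrow> B ** A \<in> UT3_odd"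
  by (simp_all add: UT3_even_iff UT3_odd_iff matrix_mult_entry_3)

lemma UT3_odd_mult: "A \<in> UT3_odd \<Longrightarrow> B \<in> UT3_odd \<Longrightarrow> A ** B = 0"
  by (simp add: UT3_odd_iff matrix_mult_entry_3 mat_3_eq_iff)

lemma UT3_even_zero: "0 \<in> UT3_even" and UT3_even_one: "mat 1 \<in> UT3_even"
  by (simp_all add: UT3_even_iff mat_def)

definition graded_assignment :: "(var \<Rightarrow> 'a::field^3^3) \<Rightarrow> bool" where
  "graded_assignment \<sigma> \<longleftrightarrow> (\<forall>i. \<sigma> (Y i) \<in> UT3_even) \<and> (\<forall>i. \<sigma> (Z i) \<in> UT3_odd)"

lemma Id_UT3_iff: "f \<in> Id_UT3 \<longleftrightarrow> f \<in> FYZ \<and> (\<forall>\<sigma>. graded_assignment \<sigma> \<longrightarrow> poly_eval \<sigma> f = 0)"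
  by (simp add: super_ids_def graded_assignment_def)

lemma word_eval_graded:
  assumes \<sigma>: "graded_assignment \<sigma>"
  shows "(even (z_degree w) \<longrightarrow> word_eval \<sigma> w \<in> UT3_even) \<and> (odd (z_degree w) \<longrightarrow> word_eval \<sigma> w \<in> UT3_odd)"
proof (induction w)
  case (Cons v w)
  then show ?case
    using \<sigma> by (cases v) (auto simp: graded_assignment_def UT3_odd_mult UT3_even_zero
        intro: UT3_even_mult UT3_even_odd_mult UT3_odd_even_mult)
qed (simp add: UT3_even_one)

lemma poly_eval_graded:
  assumes \<sigma>: "graded_assignment \<sigma>"
  shows "f \<in> F_even \<Longrightarrow> poly_eval \<sigma> f \<in> UT3_even" "f \<in> F_odd \<Longrightarrow> poly_eval \<sigma> f \<in> UT3_odd"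
proof -
  have lin: "poly_eval \<sigma> f \<in> V" if f: "f \<in> free.span {monomial w |w. P w}" and V: "mats.subspace V"
    and "\<And>w. P w \<Longrightarrow> word_eval \<sigma> w \<in> V" for f P V
    using f by (induction rule: free.span_induct_alt)
      (auto simp: poly_eval_add poly_eval_fscale poly_eval_monomial mats.subspace_0[OF V] that(3)
        intro!: mats.subspace_add[OF V] mats.subspace_scale[OF V])
  show "poly_eval \<sigma> f \<in> UT3_even" if "f \<in> F_even"
    using that[unfolded F_even_def]
    by (rule lin) (use word_eval_graded[OF \<sigma>] in \<open>auto simp: UT3_even_def\<close>)
  show "poly_eval \<sigma> f \<in> UT3_odd" if "f \<in> F_odd"
    using that[unfolded F_odd_def]
    by (rule lin) (use word_eval_graded[OF \<sigma>] in \<open>auto simp: UT3_odd_def\<close>)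
qed

text \<open>A superendomorphism followed by an evaluation is again an evaluation, at the values of
  the images of the variables. Hence identities are stable under superendomorphisms.\<close>

lemma poly_eval_super_endo:
  fixes \<phi> :: "'a::field fpoly \<Rightarrow> 'a fpoly"
  assumes \<phi>: "super_endo \<phi>" and f: "f \<in> FYZ"
  shows "poly_eval \<sigma> (\<phi> f) = poly_eval (\<lambda>v. poly_eval \<sigma> (\<phi> (monomial [v]))) f"
proof -
  let ?\<tau> = "\<lambda>v. poly_eval \<sigma> (\<phi> (monomial [v]))"
  have add: "\<And>f g. f \<in> FYZ \<Longrightarrow> g \<in> FYZ \<Longrightarrow> \<phi> (f + g) = \<phi> f + \<phi> g"
    and scale: "\<And>c f. f \<in> FYZ \<Longrightarrow> \<phi> (fscale c f) = fscale c (\<phi> f)"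
    and mult: "\<And>f g. f \<in> FYZ \<Longrightarrow> g \<in> FYZ \<Longrightarrow> \<phi> (f * g) = \<phi> f * \<phi> g"
    using \<phi> by (auto simp: super_endo_def)
  have word: "poly_eval \<sigma> (\<phi> (monomial w)) = word_eval ?\<tau> w" if "w \<noteq> []" for w
    using that
  proof (induction w)
    case (Cons v w)
    show ?case
    proof (cases "w = []")
      case False
      have "\<phi> (monomial (v # w)) = \<phi> (monomial [v]) * \<phi> (monomial w)"
        using mult[of "monomial [v]" "monomial w"] False by (simp add: monomial_mult)
      then show ?thesis using Cons False by (simp add: poly_eval_mult)
    qed simp
  qed simp
  \<comment> \<open>Membership in \<open>FYZ\<close> is carried along because \<open>\<phi>\<close>
    is additive only there.\<close>
  have "f \<in> FYZ \<and> poly_eval \<sigma> (\<phi> f) = poly_eval ?\<tau> f"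
    using f unfolding FYZ_def
  proof (induction rule: free.span_induct_alt)
    case base
    have "\<phi> 0 = 0" using scale[of 0 0] free.subspace_0[OF subspace_FYZ] by simp
    then show ?case by (simp add: free.span_zero)
  next
    case (step c x g)
    then obtain w where w: "x = monomial w" "w \<noteq> []" by blast
    then have x: "x \<in> FYZ" by simp
    have g: "g \<in> FYZ" using step by (simp add: FYZ_def)
    have cx: "fscale c x \<in> FYZ" using x free.subspace_scale[OF subspace_FYZ] by blast
    have "\<phi> (fscale c x + g) = fscale c (\<phi> x) + \<phi> g" by (simp only: add[OF cx g] scale[OF x])
    moreover have "poly_eval \<sigma> (\<phi> x) = poly_eval ?\<tau> x"
      using word[OF w(2)] by (simp only: w(1) poly_eval_monomial)
    ultimately have "poly_eval \<sigma> (\<phi> (fscale c x + g)) = poly_eval ?\<tau> (fscale c x + g)"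
      using step.IH by (simp add: poly_eval_add poly_eval_fscale)
    then show ?case using free.subspace_add[OF subspace_FYZ cx g] by (simp add: FYZ_def)
  qed
  then show ?thesis ..
qed

lemma T2_ideal_Id_UT3: "T2_ideal (Id_UT3 :: 'a::field fpoly set)"
  unfolding T2_ideal_def
proof (intro conjI ballI allI impI)
  show "Id_UT3 \<subseteq> FYZ" by (auto simp: super_ids_def)
  show "free.subspace Id_UT3" by (rule subspace_super_ids)
  show "f * g \<in> Id_UT3" "g * f \<in> Id_UT3" if "f \<in> Id_UT3" for f g :: "'a fpoly"
    using that FYZ_mult by (auto simp: Id_UT3_iff poly_eval_mult matrix_zero_mult)
  fix \<phi> :: "'a fpoly \<Rightarrow> 'a fpoly" assume \<phi>: "super_endo \<phi>"
  show "\<phi> ` Id_UT3 \<subseteq> Id_UT3"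
  proof (clarify)
    fix f :: "'a fpoly" assume f: "f \<in> Id_UT3"
    have "poly_eval \<sigma> (\<phi> f) = 0" if \<sigma>: "graded_assignment \<sigma>" for \<sigma> :: "var \<Rightarrow> 'a^3^3"
    proof -
      have "graded_assignment (\<lambda>v. poly_eval \<sigma> (\<phi> (monomial [v])))"
        using \<phi> poly_eval_graded[OF \<sigma>] unfolding graded_assignment_def super_endo_def
        by (auto simp: monomial_in_F_even monomial_in_F_odd image_subset_iff)
      then show ?thesis using f poly_eval_super_endo[OF \<phi>, of f \<sigma>] by (simp add: Id_UT3_iff)
    qed
    moreover have "\<phi> f \<in> FYZ" using \<phi> f by (simp add: super_endo_def Id_UT3_iff)
    ultimately show "\<phi> f \<in> Id_UT3" by (simp add: Id_UT3_iff)
  qed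
qed

section \<open>Commutators and \<open>a^q - a\<close> as multiples of one matrix unit\<close>

definition e23 :: "'a::field \<Rightarrow> 'a^3^3" where
  "e23 t = mat_scale t (e_mat 2 3)"

lemma e23_entry [simp]: "e23 t $ i $ j = (if i = 2 \<and> j = 3 then t else 0)"
  by (simp add: e23_def mat_scale_def e_mat_def)

lemma e23_mult: "e23 s ** e23 t = 0" "A \<in> UT3_odd \<Longrightarrow> e23 s ** A = 0"
  by (simp_all add: mat_3_eq_iff matrix_mult_entry_3 UT3_odd_iff)

text \<open>The diagonal matrices commute, so a commutator of even matrices can only have a (2,3)
  entry.\<close>

lemma UT3_commutator:
  assumes "A \<in> UT3_even" "B \<in> UT3_even"
  shows "A ** B - B ** A = e23 (A$2$3 * (B$3$3 - B$2$2) - B$2$3 * (A$3$3 - A$2$2))"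
  using assms by (simp add: mat_3_eq_iff UT3_even_iff matrix_mult_entry_3 algebra_simps)

text \<open>The matrix unit is an eigenvector of commutation with \<open>B\<close>, the eigenvalue
  being a difference of diagonal entries; iterated commutators therefore evaluate to monomials in
  these differences.\<close>

lemma e23_commutator:
  assumes "B \<in> UT3_even"
  shows "e23 t ** B - B ** e23 t = e23 (t * (B$3$3 - B$2$2))"
  using assms by (simp add: mat_3_eq_iff UT3_even_iff matrix_mult_entry_3 algebra_simps)

text \<open>Translation by 1 permutes the field, so adding 1 to every element does not change the
  sum of all elements.\<close>

lemma of_nat_CARD_eq_0: "of_nat CARD('a) = (0 :: 'a::{field, finite})"
proof -
  have "(\<Sum>x\<in>UNIV. x + 1) = (\<Sum>x\<in>UNIV. x :: 'a)"
    by (rule sum.reindex_bij_betw[where g="\<lambda>x. x"])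
      (rule bij_betw_byWitness[of _ "\<lambda>x. x - 1"]; simp)
  then show ?thesis by (simp add: sum.distrib)
qed

text \<open>The (2,3) entry of the \<open>n\<close>-th power is \<open>A$2$3\<close> times the
  divided difference of \<open>t^n\<close> at the eigenvalues \<open>A$2$2\<close> and
  \<open>A$3$3\<close>. It is stated without division, with the derivative as the case of equal
  eigenvalues.\<close>

lemma poly_eval_power:
  assumes A: "poly_eval \<sigma> f = A" "A \<in> UT3_even"
  defines "P \<equiv> \<lambda>n. poly_eval \<sigma> (f ^ n)"
  shows "P n \<in> UT3_even \<and> P n $1$1 = (A$1$1) ^ n \<and> P n $2$2 = (A$2$2) ^ n \<and> P n $3$3 = (A$3$3) ^ n
     \<and> P n $2$3 * (A$3$3 - A$2$2) = A$2$3 * ((A$3$3) ^ n - (A$2$2) ^ n)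
     \<and> (A$3$3 = A$2$2 \<longrightarrow> P n $2$3 = A$2$3 * of_nat n * (A$2$2) ^ (n - 1))"
proof (induction n)
  case 0
  then show ?case by (simp add: P_def UT3_even_one) (simp add: mat_def)
next
  case (Suc n)
  have P: "P (Suc n) = A ** P n" by (simp add: P_def poly_eval_mult A(1))
  have ent: "P (Suc n) $2$3 = A$2$2 * P n $2$3 + A$2$3 * (A$3$3) ^ n"
    using Suc A(2) by (simp add: P matrix_mult_entry_3 UT3_even_iff)
  then have "P (Suc n) $2$3 * (A$3$3 - A$2$2)
      = A$2$2 * (P n $2$3 * (A$3$3 - A$2$2)) + A$2$3 * (A$3$3) ^ n * (A$3$3 - A$2$2)"
    by (simp add: algebra_simps)
  moreover have "P (Suc n) $2$3 = A$2$3 * of_nat (Suc n) * (A$2$2) ^ n" if "A$3$3 = A$2$2"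
    unfolding ent using Suc that by (cases n) (simp_all add: algebra_simps)
  ultimately show ?case
    using Suc A(2) UT3_even_mult[OF A(2)]
    by (simp add: P) (simp add: matrix_mult_entry_3 UT3_even_iff algebra_simps)
qed

text \<open>Let \<open>x = A$3$3 - A$2$2\<close>. For \<open>x \<noteq> 0\<close> taking the
  \<open>q\<close>-th power keeps the (2,3) entry and \<open>x^(q-1) = 1\<close>; for
  \<open>x = 0\<close> the derivative carries the factor \<open>q = 0\<close>. One polynomial
  expression in \<open>x\<close> covers both cases, and it is the source of the exponent
  \<open>q - 1\<close> in the values below.\<close>

lemma poly_eval_power_card_diff:
  fixes \<sigma> :: "var \<Rightarrow> 'a::{field, finite}^3^3"
  assumes A: "poly_eval \<sigma> f = A" "A \<in> UT3_even"
  shows "poly_eval \<sigma> (f ^ CARD('a) - f) = e23 (A$2$3 * ((A$3$3 - A$2$2) ^ (CARD('a) - 1) - 1))"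
proof -
  let ?q = "CARD('a)"
  let ?P = "poly_eval \<sigma> (f ^ ?q)" and ?x = "A$3$3 - A$2$2"
  note P = poly_eval_power[OF A, of ?q]
  have "?P $2$3 - A$2$3 = A$2$3 * (?x ^ (?q - 1) - 1)"
  proof (cases "?x = 0")
    case True
    then have "?P $2$3 = 0" using P by (simp add: of_nat_CARD_eq_0)
    then show ?thesis using True CARD_field_ge_2[where 'a='a] by (simp add: power_0_left)
  next
    case False
    have "Suc (?q - 1) = ?q" using CARD_field_ge_2[where 'a='a] by simp
    then have "?x * ?x ^ (?q - 1) = ?x ^ ?q" by (metis power_Suc)
    also have "\<dots> = ?x" by (rule finite_field_power_card)
    finally have "?x ^ (?q - 1) = 1" using False by simp
    moreover have "?P $2$3 * ?x = A$2$3 * ?x" using P by (simp add: finite_field_power_card)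
    then have "?P $2$3 = A$2$3" using False by simp
    ultimately show ?thesis by simp
  qed
  then show ?thesis
    using P A(2) by (simp add: mat_3_eq_iff poly_eval_diff A(1) UT3_even_iff finite_field_power_card)
qed

text \<open>All members of the two sets take values in the line spanned by \<open>e23\<close>, and
  \<open>e23\<close> annihilates from the left both itself and the odd part.\<close>

lemma generators_in_Id_UT3:
  assumes q: "q = CARD('a::{field, finite})"
  shows "{zvar 0 * zvar 1} \<union> {w1 * zvar 0 |w1. w1 \<in> Omega1 q}
             \<union> {w1 * w2 |w1 w2. w1 \<in> Omega1 q \<and> w2 \<in> Omega2 q} \<subseteq> (Id_UT3 :: 'a fpoly set)"
proof -
  have Z: "zvar i \<in> FYZ" for i by (simp add: zvar_def)
  have omega: "\<exists>t. poly_eval \<sigma> w = e23 t"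
    if "graded_assignment \<sigma>" "w \<in> Omega1 q \<union> Omega2 q" for \<sigma> :: "var \<Rightarrow> 'a^3^3" and w
  proof -
    have e: "\<sigma> (Y i) \<in> UT3_even" for i using that by (simp add: graded_assignment_def)
    have "\<exists>t. poly_eval \<sigma> (comm (yvar i) (yvar j)) = e23 t" for i j
      using UT3_commutator[OF e e] by (auto simp: poly_eval_comm)
    moreover have "\<exists>t. poly_eval \<sigma> (yvar i ^ q - yvar i) = e23 t" for i
      unfolding q using poly_eval_power_card_diff[of \<sigma> "yvar i", OF poly_eval_var(1) e] by blast
    ultimately show ?thesis using that(2) by (auto simp: Omega1_def Omega2_def)
  qed
  have "w \<in> F_even" if "w \<in> Omega1 q" for w :: "'a fpoly"
  proof -
    have "q > 0" by (simp add: q)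
    then have "yvar 1 ^ q - yvar 1 \<in> (F_even :: 'a fpoly set)"
      by (intro free.subspace_diff[OF subspace_F_even] power_in_F_even yvar_in_F_even)
    with that show ?thesis by (auto simp: Omega1_def intro!: comm_in_F_even yvar_in_F_even)
  qed
  then have FYZ: "w * g \<in> FYZ" if "w \<in> Omega1 q" for w g :: "'a fpoly"
    using that FYZ_mult F_even_subset_FYZ by blast
  show ?thesis
  proof (intro Un_least subsetI)
    fix f :: "'a fpoly"
    show "f \<in> {zvar 0 * zvar 1} \<Longrightarrow> f \<in> Id_UT3"
      using FYZ_mult(1)[OF Z] by (auto simp: Id_UT3_iff poly_eval_mult graded_assignment_def UT3_odd_mult)
    show "f \<in> Id_UT3" if h: "f \<in> {w1 * zvar 0 |w1. w1 \<in> Omega1 q}"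
    proof -
      obtain w where w: "w \<in> Omega1 q" "f = w * zvar 0" using h by blast
      have "poly_eval \<sigma> f = 0" if "graded_assignment \<sigma>" for \<sigma> :: "var \<Rightarrow> 'a^3^3"
        using omega[OF that, of w] that w by (auto simp: poly_eval_mult graded_assignment_def e23_mult)
      then show ?thesis using FYZ w by (auto simp: Id_UT3_iff)
    qed
    show "f \<in> Id_UT3" if h: "f \<in> {w1 * w2 |w1 w2. w1 \<in> Omega1 q \<and> w2 \<in> Omega2 q}"
    proof -
      obtain w w' where w: "w \<in> Omega1 q" "w' \<in> Omega2 q" "f = w * w'" using h by blast
      have "poly_eval \<sigma> f = 0" if "graded_assignment \<sigma>" for \<sigma> :: "var \<Rightarrow> 'a^3^3"
        using omega[OF that, of w] omega[OF that, of w'] w by (auto simp: poly_eval_mult e23_mult)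
      then show ?thesis using FYZ w by (auto simp: Id_UT3_iff)
    qed
  qed
qed

subsection \<open>Values of the basis polynomials\<close>

definition mon :: "(nat \<Rightarrow> 'a::field) \<Rightarrow> nat multiset \<Rightarrow> 'a" where
  "mon x M = (\<Prod>i\<in>#M. x i)"

lemma mon_simps [simp]: "mon x {#} = 1" "mon x (add_mset i M) = x i * mon x M" "mon x (M + N) = mon x M * mon x N"
    "mon x (replicate_mset n i) = x i ^ n"
  by (simp_all add: mon_def)

lemma eval_yword:
  assumes \<sigma>: "graded_assignment \<sigma>"
  shows "poly_eval \<sigma> (yword w) \<in> UT3_even"
    "poly_eval \<sigma> (yword w) $1$1 = mon (\<lambda>i. \<sigma> (Y i)$1$1) (mset w)"
    "poly_eval \<sigma> (yword w) $2$2 = mon (\<lambda>i. \<sigma> (Y i)$2$2) (mset w)"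
proof -
  have e: "\<sigma> (Y i) \<in> UT3_even" for i using \<sigma> by (simp add: graded_assignment_def)
  show ev: "poly_eval \<sigma> (yword w) \<in> UT3_even" for w
    by (induction w) (simp_all add: UT3_even_one poly_eval_mult UT3_even_mult e)
  show "poly_eval \<sigma> (yword w) $1$1 = mon (\<lambda>i. \<sigma> (Y i)$1$1) (mset w)"
    "poly_eval \<sigma> (yword w) $2$2 = mon (\<lambda>i. \<sigma> (Y i)$2$2) (mset w)"
    using ev e by (induction w) (simp_all add: poly_eval_mult matrix_mult_entry_3 UT3_even_iff, simp_all add: mat_def)
qed

lemma eval_ad_word_e23:
  assumes \<sigma>: "graded_assignment \<sigma>" and "poly_eval \<sigma> t = e23 s"
  shows "poly_eval \<sigma> (ad_word w t) = e23 (s * mon (\<lambda>i. \<sigma> (Y i)$3$3 - \<sigma> (Y i)$2$2) (mset w))"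
  using assms(2)
proof (induction w arbitrary: t s)
  case (Cons i w)
  have "poly_eval \<sigma> (comm t (yvar i)) = e23 (s * (\<sigma> (Y i)$3$3 - \<sigma> (Y i)$2$2))"
    using \<sigma> Cons.prems by (simp add: poly_eval_comm e23_commutator graded_assignment_def)
  from Cons.IH[OF this] show ?case by (simp add: mult.assoc)
qed simp

lemma eval_ad_word_odd:
  assumes \<sigma>: "graded_assignment \<sigma>" and "poly_eval \<sigma> t \<in> UT3_odd"
  shows "poly_eval \<sigma> (ad_word w t) \<in> UT3_odd \<and> poly_eval \<sigma> (ad_word w t) $1$2
    = poly_eval \<sigma> t $1$2 * mon (\<lambda>i. \<sigma> (Y i)$2$2 - \<sigma> (Y i)$1$1) (mset w)"
  using assms(2)
proof (induction w arbitrary: t)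
  case (Cons i w)
  have e: "\<sigma> (Y i) \<in> UT3_even" using \<sigma> by (simp add: graded_assignment_def)
  have "poly_eval \<sigma> (comm t (yvar i)) \<in> UT3_odd"
    "poly_eval \<sigma> (comm t (yvar i)) $1$2 = poly_eval \<sigma> t $1$2 * (\<sigma> (Y i)$2$2 - \<sigma> (Y i)$1$1)"
    using e Cons.prems by (simp_all add: poly_eval_comm UT3_odd_iff UT3_even_iff matrix_mult_entry_3 algebra_simps)
  with Cons.IH[OF this(1)] show ?case by (simp add: mult.assoc)
qed simp

text \<open>Removing one \<open>i\<close> and one \<open>m\<close> from the index exposes the
  innermost commutator; \<open>M\<close> is then exactly the multiset of the remaining
  entries.\<close>

lemma comm_poly_Comm:
  assumes "i \<noteq> m"
  shows "comm_poly q (Comm i m (add_mset i (add_mset m M)))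
    = ad_word (replicate (count M m) m @ replicate (count M i) i
        @ word_of (filter_mset (\<lambda>k. k \<noteq> i \<and> k \<noteq> m) M)) (comm (yvar i) (yvar m))"
  using assms by simp

lemma mset_comm_poly_Comm:
  assumes "i \<noteq> m"
  shows "mset (replicate (count M m) m @ replicate (count M i) i
        @ word_of (filter_mset (\<lambda>k. k \<noteq> i \<and> k \<noteq> m) M)) = M"
  using assms by (intro multiset_eqI) auto

text \<open>The coefficient of \<open>e23\<close> at even matrices with (2,3) entries
  \<open>d\<close> and eigenvalue differences \<open>x\<close>: the products
  \<open>(d j * x m - d m * x j) * mon x (M - {#j, m#})\<close> and
  \<open>d l * (x l ^ (q - 1) - 1) * mon x M\<close>, expanded into two terms of the shape
  \<open>d i * mon x N\<close>.\<close>

fun comm_value :: "nat \<Rightarrow> comm_index \<Rightarrow> (nat \<Rightarrow> 'a) \<Rightarrow> (nat \<Rightarrow> 'a) \<Rightarrow> 'a::field" where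
  "comm_value q (Comm j m M) d x = d j * mon x (M - {#j#}) - d m * mon x (M - {#m#})"
| "comm_value q (Power l M) d x = d l * mon x (M + replicate_mset (q - 1) l) - d l * mon x M"

lemma eval_comm_poly:
  fixes \<sigma> :: "var \<Rightarrow> 'a::{field, finite}^3^3"
  assumes \<sigma>: "graded_assignment \<sigma>" and c: "valid_comm q c" and q: "q = CARD('a)"
  shows "poly_eval \<sigma> (comm_poly q c)
    = e23 (comm_value q c (\<lambda>i. \<sigma> (Y i)$2$3) (\<lambda>i. \<sigma> (Y i)$3$3 - \<sigma> (Y i)$2$2))"
proof (cases c)
  case (Comm j m M)
  have e: "\<sigma> (Y i) \<in> UT3_even" for i using \<sigma> by (simp add: graded_assignment_def)
  have jm: "j \<noteq> m" using c Comm by simp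
  obtain M' where M: "M = add_mset j (add_mset m M')"
    using c Comm jm by (metis insert_DiffM insert_noteq_member valid_comm.simps(1))
  let ?x = "\<lambda>i. \<sigma> (Y i)$3$3 - \<sigma> (Y i)$2$2"
  have "poly_eval \<sigma> (comm (yvar j) (yvar m)) = e23 (\<sigma> (Y j)$2$3 * ?x m - \<sigma> (Y m)$2$3 * ?x j)"
    by (simp add: poly_eval_comm UT3_commutator e)
  from eval_ad_word_e23[OF \<sigma> this]
  have "poly_eval \<sigma> (comm_poly q c) = e23 ((\<sigma> (Y j)$2$3 * ?x m - \<sigma> (Y m)$2$3 * ?x j) * mon ?x M')"
    unfolding Comm M comm_poly_Comm[OF jm] by (simp only: mset_comm_poly_Comm[OF jm])
  also have "\<dots> = e23 (comm_value q c (\<lambda>i. \<sigma> (Y i)$2$3) ?x)"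
    unfolding Comm M using jm by (simp add: algebra_simps)
  finally show ?thesis .
next
  case (Power l M)
  have e: "\<sigma> (Y l) \<in> UT3_even" using \<sigma> by (simp add: graded_assignment_def)
  show ?thesis
    unfolding Power
    using eval_ad_word_e23[OF \<sigma> poly_eval_power_card_diff[of \<sigma> "yvar l", OF poly_eval_var(1) e], of "word_of M"]
    by (simp add: q algebra_simps)
qed

section \<open>Consequences of the generating identities\<close>

text \<open>The spanning argument uses only that \<open>J\<close> contains the generators. It is
  applied to the identities themselves and to their intersection with an arbitrary such
  ideal.\<close>

locale generated_ideal =
  fixes J :: "'a::{field, finite} fpoly set" and q :: nat
  assumes q: "q = CARD('a)"
    and T2: "T2_ideal J"
    and gens: "{zvar 0 * zvar 1} \<union> {w1 * zvar 0 |w1. w1 \<in> Omega1 q}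
             \<union> {w1 * w2 |w1 w2. w1 \<in> Omega1 q \<and> w2 \<in> Omega2 q} \<subseteq> J"
begin

lemma q_ge_2: "q \<ge> 2"
  unfolding q by (rule CARD_field_ge_2)

lemma subspace_J: "free.subspace J"
  using T2 by (simp add: T2_ideal_def)

lemmas J_mult = T2_ideal_mult[OF T2]
lemmas J_add = free.subspace_add[OF subspace_J]
lemmas J_diff = free.subspace_diff[OF subspace_J]
lemmas J_zero = free.subspace_0[OF subspace_J]
lemmas J_trans = subspace_congruence_trans[OF subspace_J]

lemma subst_J:
  assumes "f \<in> J" "\<And>i. \<sigma> (Y i) \<in> F_even" "\<And>i. \<sigma> (Z i) \<in> F_odd"
  shows "subst \<sigma> f \<in> J"
  using T2 super_endo_subst[OF assms(2,3)] assms(1) unfolding T2_ideal_def by blast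

lemma odd_odd: "z \<in> F_odd \<Longrightarrow> z' \<in> F_odd \<Longrightarrow> z * z' \<in> J"
  using subst_J[of "zvar 0 * zvar 1" "\<lambda>v. case v of Y i \<Rightarrow> yvar 0 | Z i \<Rightarrow> if i = 0 then z else z'"]
    gens by (simp add: subst_mult yvar_in_F_even)

text \<open>The two sets of generators involve disjoint pairs of variables, so both factors of a
  product can be specialised independently.\<close>

definition even4 :: "'a fpoly \<Rightarrow> 'a fpoly \<Rightarrow> 'a fpoly \<Rightarrow> 'a fpoly \<Rightarrow> 'a fpoly \<Rightarrow> var \<Rightarrow> 'a fpoly" where
  "even4 a b c d z v =
     (case v of Y i \<Rightarrow> if i = 0 then a else if i = 1 then b else if i = 2 then c else d | Z i \<Rightarrow> z)"

lemma omega_odd: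
  assumes "a \<in> F_even" "b \<in> F_even" "z \<in> F_odd"
  shows "comm a b * z \<in> J" "(b ^ q - b) * z \<in> J"
proof -
  have "f * zvar 0 \<in> J" if "f \<in> Omega1 q" for f using gens that by blast
  then have "subst (even4 a b a a z) (f * zvar 0) \<in> J" if "f \<in> Omega1 q" for f
    using that assms by (intro subst_J) (auto simp: even4_def)
  then show "comm a b * z \<in> J" "(b ^ q - b) * z \<in> J"
    unfolding Omega1_def subst_mult
    by (fastforce simp: subst_comm subst_diff subst_power even4_def)+
qed

lemma omega_omega:
  assumes "a \<in> F_even" "b \<in> F_even" "c \<in> F_even" "d \<in> F_even"
  shows "comm a b * comm c d \<in> J" "(b ^ q - b) * comm c d \<in> J"
    "comm a b * (d ^ q - d) \<in> J" "(b ^ q - b) * (d ^ q - d) \<in> J"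
proof -
  have "f * g \<in> J" if "f \<in> Omega1 q" "g \<in> Omega2 q" for f g using gens that by blast
  then have "subst (even4 a b c d (zvar 0)) (f * g) \<in> J" if "f \<in> Omega1 q" "g \<in> Omega2 q" for f g
    using that assms by (intro subst_J) (auto simp: even4_def zvar_in_F_odd)
  then show "comm a b * comm c d \<in> J" "(b ^ q - b) * comm c d \<in> J"
      "comm a b * (d ^ q - d) \<in> J" "(b ^ q - b) * (d ^ q - d) \<in> J"
    unfolding Omega1_def Omega2_def subst_mult
    by (fastforce simp: subst_comm subst_diff subst_power even4_def)+
qed

section \<open>Elements annihilated by commutators and by \<open>a^q - a\<close>\<close>

definition left_killed :: "'a fpoly \<Rightarrow> bool" where
  "left_killed t \<longleftrightarrow> (\<forall>a\<in>F_even. (\<forall>b\<in>F_even. comm a b * t \<in> J) \<and> (a ^ q - a) * t \<in> J)"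

definition right_killed :: "'a fpoly \<Rightarrow> bool" where
  "right_killed t \<longleftrightarrow> (\<forall>a\<in>F_even. (\<forall>b\<in>F_even. t * comm a b \<in> J) \<and> t * (a ^ q - a) \<in> J)"

lemma left_killedD:
  assumes "left_killed t" "a \<in> F_even"
  shows "b \<in> F_even \<Longrightarrow> comm a b * t \<in> J" "(a ^ q - a) * t \<in> J"
  using assms by (auto simp: left_killed_def)

lemma right_killedD:
  assumes "right_killed t" "a \<in> F_even"
  shows "b \<in> F_even \<Longrightarrow> t * comm a b \<in> J" "t * (a ^ q - a) \<in> J"
  using assms by (auto simp: right_killed_def)

text \<open>For odd elements the generators provide only this half, which is why the two sides are
  kept apart.\<close>

lemma left_killed_odd: "z \<in> F_odd \<Longrightarrow> left_killed z"
  by (simp add: left_killed_def omega_odd)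

lemma left_killed_mult_right: "left_killed t \<Longrightarrow> left_killed (t * u)"
  unfolding left_killed_def by (metis J_mult(1) mult.assoc)

lemma right_killed_mult_left: "right_killed t \<Longrightarrow> right_killed (u * t)"
  unfolding right_killed_def by (metis J_mult(2) mult.assoc)

lemma power_diff_in_F_even: "a \<in> F_even \<Longrightarrow> a ^ q - a \<in> F_even"
  using q_ge_2 by (intro free.subspace_diff[OF subspace_F_even] power_in_F_even) auto

text \<open>\<open>[a, b] c = [a, b c] - b [a, c]\<close> absorbs \<open>c\<close> into commutators,
  and \<open>a^q - a\<close> is moved past \<open>c\<close> at the price of a commutator.\<close>

lemma left_killed_even_mult:
  assumes t: "left_killed t" and c: "c \<in> F_even"
  shows "left_killed (c * t)"
  unfolding left_killed_def
proof (intro ballI conjI)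
  fix a :: "'a fpoly" assume a: "a \<in> F_even"
  show "comm a b * (c * t) \<in> J" if b: "b \<in> F_even" for b
  proof -
    have "comm a (b * c) * t \<in> J" "b * (comm a c * t) \<in> J"
      using t a b c by (auto simp: left_killed_def F_even_mult intro: J_mult)
    moreover have "comm a b * (c * t) = comm a (b * c) * t - b * (comm a c * t)"
      by (simp add: comm_def algebra_simps)
    ultimately show ?thesis by (simp add: J_diff)
  qed
  have "c * ((a ^ q - a) * t) \<in> J" "comm (a ^ q - a) c * t \<in> J"
    using t a c by (auto simp: left_killed_def power_diff_in_F_even intro: J_mult)
  moreover have "(a ^ q - a) * (c * t) = c * ((a ^ q - a) * t) + comm (a ^ q - a) c * t"
    by (simp add: comm_def algebra_simps)
  ultimately show "(a ^ q - a) * (c * t) \<in> J" by (simp add: J_add)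
qed

text \<open>The mirror image, with \<open>c [a, b] = [c a, b] - [c, b] a\<close>.\<close>

lemma right_killed_even_mult:
  assumes t: "right_killed t" and c: "c \<in> F_even"
  shows "right_killed (t * c)"
  unfolding right_killed_def
proof (intro ballI conjI)
  fix a :: "'a fpoly" assume a: "a \<in> F_even"
  show "t * c * comm a b \<in> J" if b: "b \<in> F_even" for b
  proof -
    have "t * comm (c * a) b \<in> J" "t * comm c b * a \<in> J"
      using t a b c by (auto simp: right_killed_def F_even_mult intro: J_mult)
    moreover have "t * c * comm a b = t * comm (c * a) b - t * comm c b * a"
      by (simp add: comm_def algebra_simps)
    ultimately show ?thesis by (simp add: J_diff)
  qed
  have "t * (a ^ q - a) * c \<in> J" "t * comm c (a ^ q - a) \<in> J"
    using t a c by (auto simp: right_killed_def power_diff_in_F_even intro: J_mult)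
  moreover have "t * c * (a ^ q - a) = t * (a ^ q - a) * c + t * comm c (a ^ q - a)"
    by (simp add: comm_def algebra_simps)
  ultimately show "t * c * (a ^ q - a) \<in> J" by (simp add: J_add)
qed

definition killed :: "'a fpoly \<Rightarrow> bool" where
  "killed t \<longleftrightarrow> left_killed t \<and> right_killed t"

lemma killed_diff: "killed s \<Longrightarrow> killed t \<Longrightarrow> killed (s - t)"
  unfolding killed_def left_killed_def right_killed_def
  by (auto simp only: left_diff_distrib[of s t] right_diff_distrib[of _ s t] intro: J_diff)

lemma killed_comm: "killed t \<Longrightarrow> a \<in> F_even \<Longrightarrow> killed (comm t a)"
  unfolding comm_def
  by (rule killed_diff)
     (auto simp: killed_def intro: left_killed_mult_right right_killed_mult_left
        left_killed_even_mult right_killed_even_mult)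

text \<open>In the generators \<open>w1 w2\<close> a commutator can be taken as either factor, so
  both sides are covered.\<close>

lemma killed_commutator: "a \<in> F_even \<Longrightarrow> b \<in> F_even \<Longrightarrow> killed (comm a b)"
  by (simp add: killed_def left_killed_def right_killed_def omega_omega)

lemma killed_power_diff: "a \<in> F_even \<Longrightarrow> killed (a ^ q - a)"
  by (simp add: killed_def left_killed_def right_killed_def omega_omega)

lemma killed_ad_word: "killed t \<Longrightarrow> killed (ad_word w t)"
  by (induction w arbitrary: t) (simp_all add: killed_comm yvar_in_F_even)

lemma left_killed_yword: "left_killed t \<Longrightarrow> left_killed (yword w * t)"
  by (induction w) (simp_all add: mult.assoc left_killed_even_mult yvar_in_F_even)

lemma ad_word_J: "f \<in> J \<Longrightarrow> ad_word w f \<in> J"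
  by (induction w arbitrary: f) (simp_all add: comm_def J_diff J_mult)

lemma ad_word_cong: "f - g \<in> J \<Longrightarrow> ad_word w f - ad_word w g \<in> J"
  using ad_word_J[of "f - g" w] by (simp add: ad_word_diff)

text \<open>Swapping two adjacent entries changes \<open>[[s, a], b]\<close> by
  \<open>[s, [a, b]]\<close>, and both terms of the latter lie in \<open>J\<close> because
  \<open>s\<close> is killed.\<close>

lemma ad_word_permutation:
  assumes t: "killed t" and w: "mset w = mset w'"
  shows "ad_word w t - ad_word w' t \<in> J"
  using subspace_J _ w
proof (rule word_permutation)
  fix u i k v
  let ?s = "ad_word u t"
  have s: "killed ?s" using t by (rule killed_ad_word)
  have "comm (comm ?s (yvar i)) (yvar k) - comm (comm ?s (yvar k)) (yvar i)
      = ?s * comm (yvar i) (yvar k) - comm (yvar i) (yvar k) * ?s"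
    by (simp add: comm_def algebra_simps)
  also have "\<dots> \<in> J"
    using s by (intro J_diff left_killedD right_killedD yvar_in_F_even) (simp_all add: killed_def)
  finally show "ad_word (u @ i # k # v) t - ad_word (u @ k # i # v) t \<in> J"
    by (simp add: ad_word_cong)
qed

text \<open>By the exact formula for \<open>q\<close> equal entries, the difference is
  \<open>[t, y^q - y]\<close> up to further commutation.\<close>

lemma ad_word_power:
  assumes t: "killed t"
  shows "ad_word (replicate q i @ v) t - ad_word (i # v) t \<in> J"
proof -
  have "ad_word (replicate q i) t - comm t (yvar i)
      = t * (yvar i ^ q - yvar i) - (yvar i ^ q - yvar i) * t"
    unfolding q ad_word_replicate_card by (simp add: comm_def algebra_simps)
  also have "\<dots> \<in> J"
    using t by (intro J_diff left_killedD right_killedD yvar_in_F_even) (simp_all add: killed_def)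
  finally show ?thesis by (simp add: ad_word_cong)
qed

text \<open>Every correction is a commutator or some \<open>y^q - y\<close> standing before
  \<open>yword v * t\<close>, which is again left killed. Since only this half is required,
  \<open>t\<close> may contain an odd factor.\<close>

lemma yword_reduction:
  assumes t: "left_killed t"
  shows "\<exists>M. reduced q M \<and> (w \<noteq> [] \<longrightarrow> M \<noteq> {#}) \<and> yword w * t - yword (word_of M) * t \<in> J"
  using subspace_J q_ge_2
proof (rule word_reduction[where f="\<lambda>w. yword w * t"])
  fix u i k v
  have "yword u * (comm (yvar i) (yvar k) * (yword v * t)) \<in> J"
    by (intro J_mult(2) left_killedD left_killed_yword t yvar_in_F_even)
  then show "yword (u @ i # k # v) * t - yword (u @ k # i # v) * t \<in> J"
    by (simp add: comm_def algebra_simps)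
next
  fix i v
  have "(yvar i ^ q - yvar i) * (yword v * t) \<in> J"
    by (intro left_killedD left_killed_yword t yvar_in_F_even)
  then show "yword (replicate q i @ v) * t - yword (i # v) * t \<in> J"
    by (simp add: yword_replicate algebra_simps)
qed

subsection \<open>The span of the ordered commutators\<close>

text \<open>With \<open>J\<close> adjoined to the spanning set, congruence modulo \<open>J\<close>
  becomes plain membership.\<close>

definition comm_span :: "'a fpoly set" where
  "comm_span = free.span (comm_poly q ` Collect (valid_comm q) \<union> J)"

lemma subspace_comm_span: "free.subspace comm_span"
  by (simp add: comm_span_def)

lemma comm_poly_in_comm_span: "valid_comm q c \<Longrightarrow> comm_poly q c \<in> comm_span"
  by (simp add: comm_span_def free.span_base)

lemma J_subset_comm_span: "J \<subseteq> comm_span"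
  by (auto simp: comm_span_def free.span_base)

lemma comm_span_cong: "f - g \<in> J \<Longrightarrow> g \<in> comm_span \<Longrightarrow> f \<in> comm_span"
  using free.subspace_add[OF subspace_comm_span, of "f - g" g] J_subset_comm_span by auto

lemma comm_span_power_case:
  assumes t: "killed t" and k: "q \<le> count (mset w) k"
    and IH: "\<And>w'. length w' < length w \<Longrightarrow> ad_word w' t \<in> comm_span"
  shows "ad_word w t \<in> comm_span"
proof -
  obtain w' where w': "mset w = mset (replicate q k @ w')" using mset_replicate_split[OF k] by blast
  have "ad_word w t - ad_word (k # w') t \<in> J"
    using ad_word_permutation[OF t w'] ad_word_power[OF t] by (rule J_trans)
  moreover have "length (k # w') < length w" using arg_cong[OF w', of size] q_ge_2 by simp
  ultimately show ?thesis using IH comm_span_cong by blast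
qed

text \<open>An entry \<open>l\<close> can be moved to the front, where it gives zero since
  \<open>y^q - y\<close> commutes with \<open>y\<close>; \<open>q\<close> equal entries shorten the
  word; in the remaining case sorting yields form (ii).\<close>

lemma ad_word_power_diff_in_comm_span:
  "ad_word w (yvar l ^ q - yvar l) \<in> comm_span"
proof (induction "length w" arbitrary: w rule: less_induct)
  case less
  let ?t = "yvar l ^ q - yvar l :: 'a fpoly"
  have t: "killed ?t" by (simp add: killed_power_diff yvar_in_F_even)
  consider "l \<in> set w" | k where "q \<le> count (mset w) k" | "l \<notin> set w" "reduced q (mset w)"
    unfolding reduced_def by (metis not_less)
  then show ?case
  proof cases
    case 1
    then obtain u v where "w = u @ l # v" by (auto simp: in_set_conv_decomp)
    then have "ad_word w ?t - ad_word (l # u @ v) ?t \<in> J" by (intro ad_word_permutation t) simp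
    moreover have "comm ?t (yvar l) = 0" by (simp add: comm_def algebra_simps power_commutes)
    ultimately show ?thesis
      using J_subset_comm_span by (auto simp: ad_word_0)
  next
    case 2
    then show ?thesis using comm_span_power_case[OF t] less by blast
  next
    case 3
    then have "comm_poly q (Power l (mset w)) \<in> comm_span" by (intro comm_poly_in_comm_span) simp
    moreover have "ad_word w ?t - ad_word (word_of (mset w)) ?t \<in> J"
      by (intro ad_word_permutation t) simp
    ultimately show ?thesis using comm_span_cong by (metis comm_poly.simps(2))
  qed
qed

text \<open>Once the second letter of the innermost commutator is minimal among all letters,
  permuting the other entries is enough to reach form (i).\<close>

lemma ad_word_min_comm_in_comm_span:
  assumes "i \<noteq> m" "\<forall>k\<in>#M. m \<le> k" "m \<le> i" "reduced q (add_mset i (add_mset m M))" "mset w = M"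
  shows "ad_word w (comm (yvar i) (yvar m)) \<in> comm_span"
proof -
  let ?w = "replicate (count M m) m @ replicate (count M i) i
        @ word_of (filter_mset (\<lambda>k. k \<noteq> i \<and> k \<noteq> m) M)"
  have "mset ?w = M" by (rule mset_comm_poly_Comm[OF assms(1)])
  then have "ad_word w (comm (yvar i) (yvar m)) - ad_word ?w (comm (yvar i) (yvar m)) \<in> J"
    using assms(5) by (intro ad_word_permutation killed_commutator yvar_in_F_even) simp
  moreover have "comm_poly q (Comm i m (add_mset i (add_mset m M))) \<in> comm_span"
    using assms by (intro comm_poly_in_comm_span) auto
  ultimately show ?thesis using comm_span_cong unfolding comm_poly_Comm[OF assms(1)] by blast
qed

lemma comm_anti: "comm a b = - comm b a"
  by (simp add: comm_def)

lemma jacobi: "comm (comm a b) c = comm (comm a c) b - comm (comm b c) a"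
  by (simp add: comm_def algebra_simps)

text \<open>Letters of too high multiplicity are removed by induction on the length; afterwards
  antisymmetry or the Jacobi identity brings the smallest letter into the second place of the
  innermost commutator.\<close>

lemma ad_word_comm_in_comm_span:
  "ad_word w (comm (yvar i) (yvar j)) \<in> comm_span"
proof (induction "length w" arbitrary: w i j rule: less_induct)
  case less
  let ?M = "mset w" and ?c = "\<lambda>i j. comm (yvar i) (yvar j) :: 'a fpoly"
  have k: "killed (?c i j)" for i j by (simp add: killed_commutator yvar_in_F_even)
  have anti: "ad_word w (?c i j) \<in> comm_span" if "ad_word w (?c j i) \<in> comm_span" for w i j
    using free.subspace_neg[OF subspace_comm_span that]
    by (simp add: comm_anti[of "yvar i"] ad_word_minus)
  \<comment> \<open>\<open>[y\<^sub>i, y\<^sub>j\<^sup>(\<^sup>q\<^sup>)] = [y\<^sub>i, y\<^sub>j] - [y\<^sub>j\<^sup>q - y\<^sub>j, y\<^sub>i]\<close> lowers the degree.\<close>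
  have almost: "ad_word w (?c i j) \<in> comm_span" if cj: "q - 1 \<le> count ?M j" for i j
  proof -
    obtain w' where w': "?M = mset (replicate (q - 1) j @ w')" using mset_replicate_split[OF cj] by blast
    have "ad_word (replicate (q - 1) j) (?c i j) = ad_word (replicate q j) (yvar i)"
      using q_ge_2 by (cases q) simp_all
    also have "\<dots> = ?c i j - comm (yvar j ^ q - yvar j) (yvar i)"
      unfolding q ad_word_replicate_card by (simp add: comm_def algebra_simps)
    finally have "ad_word (replicate (q - 1) j @ w') (?c i j)
        = ad_word w' (?c i j) - ad_word (i # w') (yvar j ^ q - yvar j)"
      unfolding ad_word_simps by (simp only: ad_word_diff)
    moreover have "length w' < length w" using arg_cong[OF w', of size] q_ge_2 by simp
    ultimately have "ad_word (replicate (q - 1) j @ w') (?c i j) \<in> comm_span"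
      using less ad_word_power_diff_in_comm_span free.subspace_diff[OF subspace_comm_span] by metis
    then show ?thesis by (rule comm_span_cong[OF ad_word_permutation[OF k w']])
  qed
  \<comment> \<open>All letters are counted here, so \<open>q - 1\<close> copies of \<open>i\<close>
    or \<open>j\<close> among the outer entries are already too many.\<close>
  let ?T = "add_mset i (add_mset j ?M)"
  have red: "reduced q ?T"
    if "i \<noteq> j" "\<not> (\<exists>k. q \<le> count ?M k)" "\<not> q - 1 \<le> count ?M j" "\<not> q - 1 \<le> count ?M i"
    using that by (auto simp: reduced_def not_le)
  consider "i = j" | k where "q \<le> count ?M k" | "q - 1 \<le> count ?M j" | "q - 1 \<le> count ?M i"
    | "i \<noteq> j" "reduced q ?T"
    using red by blast
  then show ?case
  proof cases
    case 1
    then show ?thesis using J_zero J_subset_comm_span by (auto simp: comm_def)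
  next
    case 2
    then show ?thesis using comm_span_power_case[OF k] less by blast
  next
    case 3
    then show ?thesis by (rule almost)
  next
    case 4
    then show ?thesis by (intro anti[OF almost])
  next
    case 5
    define m where "m = Min (set_mset ?T)"
    have m: "m \<in># ?T" "\<forall>k\<in>#?T. m \<le> k"
      unfolding m_def by (rule Min_in, simp, simp, intro ballI Min_le, simp)
    consider "m = j" | "m = i" | "m \<noteq> i" "m \<noteq> j" "m \<in> set w" using m(1) by auto
    then show ?thesis
    proof cases
      case 1
      then show ?thesis using m 5 by (intro ad_word_min_comm_in_comm_span[where M="?M"]) auto
    next
      case 2
      have "reduced q (add_mset j (add_mset i ?M))" by (subst add_mset_commute) (rule 5(2))
      moreover have "\<forall>k\<in>#?M. i \<le> k" "i \<le> j" using m(2) unfolding 2 by simp_all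
      ultimately show ?thesis using 5(1)
        by (intro anti[OF ad_word_min_comm_in_comm_span[where M="?M"]]) auto
    next
      case 3
      then obtain u v where uv: "w = u @ m # v" by (auto simp: in_set_conv_decomp)
      have "ad_word w (?c i j) - ad_word (m # u @ v) (?c i j) \<in> J"
        using uv by (intro ad_word_permutation k) simp
      \<comment> \<open>Jacobi: \<open>[[i, j], m] = [[i, m], j] - [[j, m], i]\<close>. Both
        innermost commutators now end in the minimal letter, and the full multiset of letters is
        unchanged.\<close>
      moreover have "ad_word (m # u @ v) (?c i j) = ad_word (j # u @ v) (?c i m) - ad_word (i # u @ v) (?c j m)"
        unfolding ad_word_simps(2) by (simp add: jacobi[of "yvar i" "yvar j"] ad_word_diff)
      moreover have "ad_word (j # u @ v) (?c i m) \<in> comm_span"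
        using m 5 3 by (intro ad_word_min_comm_in_comm_span[where M="mset (j # u @ v)"])
          (simp_all add: uv add_mset_commute[of m j])
      moreover have "ad_word (i # u @ v) (?c j m) \<in> comm_span"
        using m 5 3 by (intro ad_word_min_comm_in_comm_span[where M="mset (i # u @ v)"])
          (simp_all add: uv add_mset_commute[of m i] add_mset_commute[of j i] add_mset_commute[of j m])
      ultimately show ?thesis
        using comm_span_cong free.subspace_diff[OF subspace_comm_span] by metis
    qed
  qed
qed

subsection \<open>Spanning\<close>

text \<open>Without its ordering conditions, either form is an iterated commutator of a killed
  element. This is enough for killedness and for closure under one more commutation.\<close>

lemma comm_poly_cases:
  assumes "valid_comm q c"
  obtains w i j where "(comm_poly q c :: 'a fpoly) = ad_word w (comm (yvar i) (yvar j))"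
  | w l where "(comm_poly q c :: 'a fpoly) = ad_word w (yvar l ^ q - yvar l)"
proof (cases c)
  case (Comm j m M)
  \<comment> \<open>The first of the \<open>count M m\<close> entries \<open>m\<close> goes into the
    innermost commutator.\<close>
  then have "comm_poly q c = ad_word (replicate (count M m - 1) m @ replicate (count M j - 1) j
     @ word_of (filter_mset (\<lambda>i. i \<noteq> j \<and> i \<noteq> m) M)) (comm (yvar j) (yvar m))"
    using assms by (cases "count M m") (auto simp: count_eq_zero_iff)
  then show ?thesis by (rule that(1))
next
  case (Power l M)
  then show ?thesis using that(2) by (metis comm_poly.simps(2))
qed

lemma left_killed_comm_poly:
  assumes "valid_comm q c"
  shows "left_killed (comm_poly q c)"
proof -
  have "killed (comm_poly q c)"
    using assms by (cases rule: comm_poly_cases)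
      (simp_all only: killed_ad_word killed_commutator killed_power_diff yvar_in_F_even)
  then show ?thesis by (simp add: killed_def)
qed

lemma comm_poly_comm_in_comm_span:
  assumes "valid_comm q c"
  shows "comm (comm_poly q c) (yvar k) \<in> comm_span"
  using assms
proof (cases rule: comm_poly_cases)
  case (1 w i j)
  then show ?thesis using ad_word_comm_in_comm_span[of "w @ [k]" i j] by simp
next
  case (2 w l)
  then show ?thesis using ad_word_power_diff_in_comm_span[of "w @ [k]" l] by simp
qed

section \<open>Products of a \<open>y\<close>-word and an ordered commutator\<close>

definition y_comm_span :: "'a fpoly set" where
  "y_comm_span = free.span ({yword (word_of R) * comm_poly q c |R c. reduced q R \<and> valid_comm q c} \<union> J)"

lemma subspace_y_comm_span: "free.subspace y_comm_span"
  by (simp add: y_comm_span_def)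

lemma J_subset_y_comm_span: "J \<subseteq> y_comm_span"
  by (auto simp: y_comm_span_def free.span_base)

lemma y_comm_span_cong: "f - g \<in> J \<Longrightarrow> g \<in> y_comm_span \<Longrightarrow> f \<in> y_comm_span"
  using free.subspace_add[OF subspace_y_comm_span, of "f - g" g] J_subset_y_comm_span by auto

lemma yword_comm_poly_in_y_comm_span:
  assumes "valid_comm q c"
  shows "yword w * comm_poly q c \<in> y_comm_span"
proof -
  obtain M where M: "reduced q M" "yword w * comm_poly q c - yword (word_of M) * comm_poly q c \<in> J"
    using yword_reduction[OF left_killed_comm_poly[OF assms]] by blast
  have "yword (word_of M) * comm_poly q c \<in> y_comm_span"
    unfolding y_comm_span_def using M assms by (intro free.span_base) blast
  with M(2) show ?thesis by (rule y_comm_span_cong)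
qed

lemma yword_comm_span:
  assumes "f \<in> comm_span"
  shows "yword w * f \<in> y_comm_span"
  using assms unfolding comm_span_def
proof (induction rule: free.span_induct_alt)
  case base
  then show ?case by (simp add: free.subspace_0[OF subspace_y_comm_span])
next
  case (step c x g)
  then have "yword w * x \<in> y_comm_span"
    using yword_comm_poly_in_y_comm_span J_subset_y_comm_span J_mult(2) by blast
  with step.IH show ?case
    by (simp add: distrib_left fscale_mult_right free.subspace_add[OF subspace_y_comm_span]
        free.subspace_scale[OF subspace_y_comm_span])
qed

text \<open>\<open>p y = y p + [p, y]\<close>, and the last commutator is again a combination of
  ordered ones modulo \<open>J\<close>. Commutators arising in the middle of a word can thus be
  pushed to its right end.\<close>

lemma y_comm_span_yvar:
  assumes "f \<in> y_comm_span"
  shows "f * yvar i \<in> y_comm_span"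
  using assms[unfolded y_comm_span_def]
proof (induction rule: free.span_induct_alt)
  case base
  then show ?case by (simp add: free.subspace_0[OF subspace_y_comm_span])
next
  case (step c x g)
  have "x * yvar i \<in> y_comm_span"
  proof (cases "x \<in> J")
    case True
    then show ?thesis using J_subset_y_comm_span J_mult(1) by blast
  next
    case False
    then obtain R c' where x: "x = yword (word_of R) * comm_poly q c'" "valid_comm q c'" using step(1) by blast
    have "x * yvar i = yword (word_of R @ [i]) * comm_poly q c' + yword (word_of R) * comm (comm_poly q c') (yvar i)"
      by (simp add: x(1) comm_def algebra_simps)
    moreover have "yword (word_of R) * comm (comm_poly q c') (yvar i) \<in> y_comm_span"
      by (intro yword_comm_span comm_poly_comm_in_comm_span x)
    ultimately show ?thesis
      using free.subspace_add[OF subspace_y_comm_span] yword_comm_poly_in_y_comm_span[OF x(2)] by metis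
  qed
  then show ?case using step
    by (simp add: distrib_right fscale_mult_left free.subspace_add[OF subspace_y_comm_span]
        free.subspace_scale[OF subspace_y_comm_span])
qed

lemma y_comm_span_right: "f \<in> y_comm_span \<Longrightarrow> f * yword w \<in> y_comm_span"
proof (induction w arbitrary: f)
  case (Cons i w)
  then show ?case using Cons.IH[OF y_comm_span_yvar[OF Cons.prems, of i]] by (simp add: mult.assoc)
qed simp

text \<open>With no killed factor behind the word, the corrections need not lie in \<open>J\<close>;
  they are collected in the larger space instead.\<close>

lemma yword_modulo_y_comm_span:
  "\<exists>M. reduced q M \<and> (w \<noteq> [] \<longrightarrow> M \<noteq> {#}) \<and> yword w - yword (word_of M) \<in> y_comm_span"
  using subspace_y_comm_span q_ge_2
proof (rule word_reduction)
  fix u i k v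
  have "yword u * (comm (yvar i) (yvar k)) * yword v \<in> y_comm_span"
    using ad_word_comm_in_comm_span[of "[]" i k] by (intro y_comm_span_right yword_comm_span) simp
  then show "yword (u @ i # k # v) - yword (u @ k # i # v) \<in> y_comm_span"
    by (simp add: comm_def algebra_simps)
next
  fix i v
  have "yword [] * (yvar i ^ q - yvar i) * yword v \<in> y_comm_span"
    using ad_word_power_diff_in_comm_span[of "[]" i] by (intro y_comm_span_right yword_comm_span) simp
  then show "yword (replicate q i @ v) - yword (i # v) \<in> y_comm_span"
    by (simp add: yword_replicate algebra_simps)
qed

section \<open>The span of the whole basis modulo \<open>J\<close>\<close>

definition total_span :: "'a fpoly set" where
  "total_span = free.span (basis_polys q \<union> J)"

lemma subspace_total_span: "free.subspace total_span"
  by (simp add: total_span_def)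

lemma J_subset_total_span: "J \<subseteq> total_span"
  by (auto simp: total_span_def free.span_base)

lemma total_span_cong: "f - g \<in> J \<Longrightarrow> g \<in> total_span \<Longrightarrow> f \<in> total_span"
  using free.subspace_add[OF subspace_total_span, of "f - g" g] J_subset_total_span by auto

lemma basis_poly_in_total_span: "x \<in> basis_indices q \<Longrightarrow> basis_poly q x \<in> total_span"
  using basis_polys_eq_image[of q] q_ge_2 by (auto simp: total_span_def intro!: free.span_base)

lemma y_comm_span_subset_total_span: "y_comm_span \<subseteq> total_span"
proof -
  have "yword (word_of R) * comm_poly q c \<in> total_span" if "reduced q R" "valid_comm q c" for R c
    using basis_poly_in_total_span[of "(R, None, Some c)"] that by (simp add: basis_indices_def)
  then show ?thesis
    unfolding y_comm_span_def using J_subset_total_span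
    by (intro free.span_minimal subspace_total_span) auto
qed

lemma yword_in_total_span:
  assumes "w \<noteq> []"
  shows "yword w \<in> total_span"
proof -
  obtain M where M: "reduced q M" "M \<noteq> {#}" "yword w - yword (word_of M) \<in> y_comm_span"
    using yword_modulo_y_comm_span assms by blast
  have "yword (word_of M) \<in> total_span"
    using basis_poly_in_total_span[of "(M, None, None)"] M by (simp add: basis_indices_def)
  with M(3) show ?thesis
    using free.subspace_add[OF subspace_total_span, of "yword w - yword (word_of M)" "yword (word_of M)"]
      y_comm_span_subset_total_span by auto
qed

lemma ad_word_in_F_odd: "t \<in> F_odd \<Longrightarrow> ad_word w t \<in> F_odd"
  by (induction w arbitrary: t)
     (simp_all add: comm_def free.subspace_diff[OF subspace_F_odd] F_odd_even_mult F_even_odd_mult yvar_in_F_even)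

text \<open>The letters behind \<open>z\<close> either pass to its left or become entries of its
  commutator. Those on the left are then reduced, since an odd element followed by any further
  factor is left killed. A submultiset of a reduced multiset is reduced, so the exponents inside the
  commutator stay below \<open>q\<close>.\<close>

lemma one_z_in_total_span:
  assumes M: "reduced q M" and co: "\<And>c. co = Some c \<Longrightarrow> valid_comm q c"
  shows "yword u * zvar j * yword (word_of M) * comm_factor q co \<in> total_span"
proof -
  let ?S = "{yword u' * ad_word w' (zvar j) |u' w'. sorted w' \<and> mset w' \<subseteq># mset (word_of M)} :: 'a fpoly set"
  have "yword u * f * comm_factor q co \<in> total_span" if "f \<in> free.span ?S" for f
    using that
  proof (induction rule: free.span_induct_alt)
    case base
    then show ?case by (simp add: free.subspace_0[OF subspace_total_span])
  next
    case (step c x g)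
    then obtain u' w' where x: "x = yword u' * ad_word w' (zvar j)" and w': "sorted w'" "mset w' \<subseteq># M" by auto
    let ?t = "ad_word w' (zvar j) * comm_factor q co :: 'a fpoly"
    have "left_killed ?t"
      by (intro left_killed_mult_right left_killed_odd ad_word_in_F_odd zvar_in_F_odd)
    from yword_reduction[OF this, of "u @ u'"] obtain R where
      R: "reduced q R" "yword (u @ u') * ?t - yword (word_of R) * ?t \<in> J" by blast
    have "word_of (mset w') = w'" using w'(1) by (simp add: sorted_sort_id)
    moreover have "reduced q (mset w')"
      using M mset_subset_eq_count[OF w'(2)] unfolding reduced_def by (meson le_less_trans)
    ultimately have "yword (word_of R) * ?t \<in> total_span"
      using basis_poly_in_total_span[of "(R, Some (j, mset w'), co)"] R(1) co
      by (auto simp: basis_indices_def mult.assoc simp del: sorted_list_of_multiset_mset)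
    from total_span_cong[OF R(2) this] have "yword u * x * comm_factor q co \<in> total_span"
      by (simp add: x mult.assoc)
    with step.IH show ?case
      by (simp add: distrib_left distrib_right fscale_mult_right fscale_mult_left
        free.subspace_add[OF subspace_total_span] free.subspace_scale[OF subspace_total_span])
  qed
  from this[OF mult_yword_expand[of "word_of M" "zvar j"]] show ?thesis by (simp add: mult.assoc)
qed

lemma z_y_comm_span:
  assumes "f \<in> y_comm_span"
  shows "yword u * zvar j * f \<in> total_span"
  using assms[unfolded y_comm_span_def]
proof (induction rule: free.span_induct_alt)
  case base
  then show ?case by (simp add: free.subspace_0[OF subspace_total_span])
next
  case (step c x g)
  have "yword u * zvar j * x \<in> total_span"
  proof (cases "x \<in> J")
    case True
    then show ?thesis using J_subset_total_span J_mult(2) by blast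
  next
    case False
    then obtain R c' where x: "x = yword (word_of R) * comm_poly q c'" "reduced q R" "valid_comm q c'"
      using step(1) by blast
    then show ?thesis using one_z_in_total_span[of R "Some c'" u j] by (simp add: mult.assoc)
  qed
  with step.IH show ?case
    by (simp add: distrib_left fscale_mult_right
        free.subspace_add[OF subspace_total_span] free.subspace_scale[OF subspace_total_span])
qed

lemma split_at_Z: "(\<exists>u. w = map Y u) \<or> (\<exists>u j w'. w = map Y u @ Z j # w')"
proof (induction w)
  case (Cons v w)
  then show ?case
  proof (cases v)
    case (Y i)
    from Cons show ?thesis unfolding Y by (metis append_Cons list.simps(9))
  next
    case (Z j)
    then show ?thesis by (metis append_Nil list.simps(8))
  qed
qed simp

lemma monomial_in_total_span:
  assumes "w \<noteq> []"
  shows "monomial w \<in> total_span"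
proof -
  consider u where "w = map Y u" | u j v where "w = map Y u @ Z j # map Y v"
    | u j v k w' where "w = map Y u @ Z j # map Y v @ Z k # w'"
    using split_at_Z by metis
  then show ?thesis
  proof cases
    case 1
    then show ?thesis using yword_in_total_span[of u] assms by (simp add: yword_def)
  next
    case 2
    obtain M where M: "reduced q M" "yword v - yword (word_of M) \<in> y_comm_span"
      using yword_modulo_y_comm_span by blast
    have "yword u * zvar j * yword (word_of M) \<in> total_span"
      using one_z_in_total_span[OF M(1), of None] by simp
    from free.subspace_add[OF subspace_total_span z_y_comm_span[OF M(2), of u j] this]
    have "yword u * zvar j * yword v \<in> total_span" by (simp only: right_diff_distrib diff_add_cancel)
    then show ?thesis by (simp add: 2 yword_def zvar_def monomial_mult)
  next
    case 3
    \<comment> \<open>The first \<open>z\<close> together with the \<open>y\<close>-word after it is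
      again odd, so the identity \<open>z1 z2\<close> also covers letters in between.\<close>
    have "(zvar j * yword v) * zvar k \<in> J"
      by (intro odd_odd) (simp_all add: zvar_def yword_def monomial_mult monomial_in_F_odd)
    then have "yword u * ((zvar j * yword v) * zvar k) * monomial w' \<in> J"
      using J_mult by blast
    then show ?thesis
      using J_subset_total_span by (auto simp: 3 yword_def zvar_def monomial_mult)
  qed
qed

lemma FYZ_subset_total_span: "FYZ \<subseteq> total_span"
  unfolding FYZ_def
  by (intro free.span_minimal subspace_total_span) (use monomial_in_total_span in auto)

lemma FYZ_decomposition:
  assumes "f \<in> FYZ"
  shows "\<exists>g\<in>free.span (basis_polys q). f - g \<in> J"
proof -
  have "free.span J = J" using subspace_J by (simp add: free.span_eq_iff)
  moreover have "f \<in> free.span (basis_polys q \<union> J)"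
    using assms FYZ_subset_total_span by (auto simp: total_span_def)
  ultimately obtain g h where "f = g + h" "g \<in> free.span (basis_polys q)" "h \<in> J"
    unfolding free.span_Un by blast
  then show ?thesis by (intro bexI[of _ g]) auto
qed

end

section \<open>Linear independence\<close>

text \<open>Independence as a family: equal functions at different indices would violate it, so
  injectivity of the indexing is included.\<close>

definition lin_indep_on :: "'i set \<Rightarrow> ('i \<Rightarrow> 'x \<Rightarrow> 'a::field) \<Rightarrow> bool" where
  "lin_indep_on I f \<longleftrightarrow>
     (\<forall>T k. finite T \<and> T \<subseteq> I \<and> (\<forall>x. (\<Sum>i\<in>T. k i * f i x) = 0) \<longrightarrow> (\<forall>i\<in>T. k i = 0))"

lemma lin_indep_onD:
  assumes "lin_indep_on I f" "finite T" "T \<subseteq> I" "\<And>x. (\<Sum>i\<in>T. k i * f i x) = 0" "i \<in> T"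
  shows "k i = 0"
  using assms unfolding lin_indep_on_def by blast

lemma lin_indep_on_reindexD:
  assumes f: "lin_indep_on I f" and T: "finite T" and h: "inj_on h T" "h ` T \<subseteq> I"
    and eq: "\<And>x. (\<Sum>i\<in>T. k i * f (h i) x) = 0" and i: "i \<in> T"
  shows "k i = 0"
proof -
  have "(\<Sum>j\<in>h ` T. k (the_inv_into T h j) * f j x) = 0" for x
    using eq[of x] h(1) by (simp add: sum.reindex the_inv_into_f_f)
  from lin_indep_onD[OF f _ h(2) this, of "h i"] show ?thesis
    using T i h(1) by (simp add: the_inv_into_f_f)
qed

text \<open>For fixed \<open>x\<close>, independence of \<open>g\<close> annihilates every inner sum
  over \<open>i\<close>; as this holds for all \<open>x\<close>, independence of \<open>f\<close>
  finishes the argument.\<close>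

lemma lin_indep_on_tensor:
  assumes f: "lin_indep_on I f" and g: "lin_indep_on J g"
  shows "lin_indep_on (I \<times> J) (\<lambda>(i, j) (x, y). f i x * g j y)"
  unfolding lin_indep_on_def
proof (intro allI impI ballI, elim conjE)
  fix T :: "('a \<times> 'd) set" and k p
  assume T: "finite T" "T \<subseteq> I \<times> J" and p: "p \<in> T"
    and eq: "\<forall>z. (\<Sum>p\<in>T. k p * (case p of (i, j) \<Rightarrow> \<lambda>(x, y). f i x * g j y) z) = 0"
  \<comment> \<open>Extension by zero turns \<open>T\<close> into a full rectangle, on which the
    double sum can be exchanged.\<close>
  define k' where "k' p = (if p \<in> T then k p else 0)" for p
  have inner: "(\<Sum>i\<in>fst ` T. k' (i, j) * f i x) = 0" if j: "j \<in> snd ` T" for j x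
  proof (rule lin_indep_onD[OF g _ _ _ j])
    show "finite (snd ` T)" "snd ` T \<subseteq> J" using T by auto
    fix y
    have "(\<Sum>j\<in>snd ` T. (\<Sum>i\<in>fst ` T. k' (i, j) * f i x) * g j y)
        = (\<Sum>(i, j)\<in>fst ` T \<times> snd ` T. k' (i, j) * (f i x * g j y))"
      unfolding sum_distrib_right by (subst sum.swap) (simp add: sum.cartesian_product mult.assoc)
    also have "\<dots> = (\<Sum>(i, j)\<in>T. k (i, j) * (f i x * g j y))"
      using T(1) by (intro sum.mono_neutral_cong_right) (auto simp: k'_def rev_image_eqI)
    also have "\<dots> = 0" using eq[rule_format, of "(x, y)"] by (simp add: case_prod_unfold)
    finally show "(\<Sum>j\<in>snd ` T. (\<Sum>i\<in>fst ` T. k' (i, j) * f i x) * g j y) = 0" .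
  qed
  obtain i j where ij: "p = (i, j)" by force
  have "k' (i, j) = 0"
    by (rule lin_indep_onD[OF f _ _ inner, of j]) (use T p ij in \<open>force+\<close>)
  then show "k p = 0" using p ij by (simp add: k'_def)
qed

lemma lin_indep_on_coordinates: "lin_indep_on UNIV (\<lambda>(j :: nat) u. u j :: 'a::field)"
  unfolding lin_indep_on_def
proof (intro allI impI ballI, elim conjE)
  fix T :: "nat set" and k i
  assume T: "finite T" and i: "i \<in> T" and eq: "\<forall>u :: nat \<Rightarrow> 'a. (\<Sum>j\<in>T. k j * u j) = 0"
  have "(\<Sum>j\<in>T. k j * (if j = i then 1 else 0)) = 0"
    using eq[rule_format, of "\<lambda>j. if j = i then 1 else 0"] .
  with T i show "k i = 0" by (simp add: if_distrib cong: if_cong)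
qed

lemma lin_indep_on_powers: "lin_indep_on {..<CARD('a)} (\<lambda>n (y :: 'a::{field, finite}). y ^ n)"
  unfolding lin_indep_on_def
proof (intro allI impI ballI, elim conjE)
  fix T k i
  assume T: "finite T" "T \<subseteq> {..<CARD('a)}" and i: "i \<in> T" and eq: "\<forall>y :: 'a. (\<Sum>n\<in>T. k n * y ^ n) = 0"
  let ?p = "\<Sum>n\<in>T. monom (k n) n"
  have cf: "coeff ?p n = (if n \<in> T then k n else 0)" for n
    using T(1) by (simp add: coeff_sum coeff_monom)
  have "?p = 0"
    by (rule poly_eq_0_finite_field) (use eq T(2) in \<open>auto simp: poly_sum poly_monom cf\<close>)
  then show "k i = 0" using cf[of i] i by simp
qed

text \<open>Reduced polynomials over a finite field are determined by their values. The induction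
  adds one variable at a time, its powers forming a tensor factor.\<close>

lemma lin_indep_on_mon:
  "lin_indep_on {M. reduced CARD('a) M} (\<lambda>M (x :: nat \<Rightarrow> 'a::{field, finite}). mon x M)"
proof -
  let ?q = "CARD('a)" and ?mon = "\<lambda>M (x :: nat \<Rightarrow> 'a). mon x M"
  have fin: "lin_indep_on {M. reduced ?q M \<and> set_mset M \<subseteq> V} ?mon" if "finite V" for V
    using that
  proof (induction V)
    case empty
    show ?case unfolding lin_indep_on_def
    proof (intro allI impI ballI, elim conjE)
      fix T k M
      assume T: "T \<subseteq> {M. reduced ?q M \<and> set_mset M \<subseteq> {}}" "M \<in> T" and eq: "\<forall>x. (\<Sum>i\<in>T. k i * ?mon i x) = 0"
      then have "T = {{#}}" "M = {#}" by auto
      with eq show "k M = 0" by simp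
    qed
  next
    case (insert v V)
    let ?h = "\<lambda>M. (filter_mset (\<lambda>i. i \<noteq> v) M, count M v)"
    note tensor = lin_indep_on_tensor[OF insert.IH lin_indep_on_powers]
    show ?case unfolding lin_indep_on_def
    proof (intro allI impI ballI, elim conjE)
      fix T k M
      assume T: "finite T" "T \<subseteq> {M. reduced ?q M \<and> set_mset M \<subseteq> insert v V}" "M \<in> T"
        and eq: "\<forall>x. (\<Sum>i\<in>T. k i * ?mon i x) = 0"
      have split: "M = filter_mset (\<lambda>i. i \<noteq> v) M + replicate_mset (count M v) v" for M
        by (rule multiset_eqI) auto
      show "k M = 0"
      proof (rule lin_indep_on_reindexD[OF tensor T(1) _ _ _ T(3), of ?h])
        show "inj_on ?h T" by (rule inj_onI) (metis split prod.inject)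
        show "?h ` T \<subseteq> {M. reduced ?q M \<and> set_mset M \<subseteq> V} \<times> {..<?q}"
        proof (rule image_subsetI)
          fix M assume "M \<in> T"
          then have "reduced ?q M" "set_mset M \<subseteq> insert v V" using T(2) by auto
          then show "?h M \<in> {M. reduced ?q M \<and> set_mset M \<subseteq> V} \<times> {..<?q}"
            by (auto simp: reduced_def)
        qed
        fix z :: "(nat \<Rightarrow> 'a) \<times> 'a"
        obtain x y where z: "z = (x, y)" by force
        \<comment> \<open>The value of the new variable is chosen separately from \<open>x\<close>;
          the other factor does not contain \<open>v\<close>.\<close>
        have "?mon M (x(v := y)) = ?mon (filter_mset (\<lambda>i. i \<noteq> v) M) x * y ^ count M v" for M
        proof -
          have "?mon (filter_mset (\<lambda>i. i \<noteq> v) M) (x(v := y)) = ?mon (filter_mset (\<lambda>i. i \<noteq> v) M) x"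
            unfolding mon_def by (intro arg_cong[where f=prod_mset] image_mset_cong) auto
          then show ?thesis by (subst split[of M]) (simp del: filter_union_mset)
        qed
        then show "(\<Sum>i\<in>T. k i * (case ?h i of (i, j) \<Rightarrow> \<lambda>(x, y). ?mon i x * y ^ j) z) = 0"
          using eq[rule_format, of "x(v := y)"] by (simp add: z)
      qed
    qed
  qed
  show ?thesis unfolding lin_indep_on_def
  proof (intro allI impI ballI, elim conjE)
    fix T k M
    assume T: "finite T" "T \<subseteq> {M. reduced ?q M}" "M \<in> T" and eq: "\<forall>x. (\<Sum>i\<in>T. k i * ?mon i x) = 0"
    \<comment> \<open>Finitely many monomials involve only finitely many variables.\<close>
    have "finite (\<Union>(set_mset ` T))" using T(1) by auto
    from lin_indep_onD[OF fin[OF this] T(1) _ _ T(3)] show "k M = 0" using T(2) eq by blast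
  qed
qed

text \<open>The values of the ordered commutators are differences of two of the independent functions
  \<open>d\<^sub>l x\<^sup>M\<close>; the first of them is a leading term.  Those with \<open>x\<^sub>l\<close>-exponent \<open>q - 1\<close> occur only in
  the values of \<open>Power\<close>, and then \<open>d\<^sub>j x\<^sup>M\<close> with \<open>j > Min M\<close> only in one value of \<open>Comm\<close>.\<close>

fun comm_terms :: "nat \<Rightarrow> comm_index \<Rightarrow> (nat \<times> nat multiset) \<times> (nat \<times> nat multiset)" where
  "comm_terms q (Comm j m M) = ((j, M - {#j#}), (m, M - {#m#}))"
| "comm_terms q (Power l M) = ((l, M + replicate_mset (q - 1) l), (l, M))"

lemma lin_indep_on_comm_value:
  assumes q: "q = CARD('a::{field, finite})"
  shows "lin_indep_on {c. valid_comm q c} (\<lambda>c (d, x). comm_value q c d x :: 'a)"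
  unfolding lin_indep_on_def
proof (intro allI impI ballI, elim conjE)
  fix T k c
  assume T: "finite T" "T \<subseteq> {c. valid_comm q c}" and c: "c \<in> T"
    and eq: "\<forall>z. (\<Sum>c\<in>T. k c * (case z of (d, x) \<Rightarrow> comm_value q c d x)) = (0 :: 'a)"
  have q2: "q \<ge> 2" unfolding q by (rule CARD_field_ge_2)
  let ?D = "\<lambda>(l :: nat, M) (d, x). d l * mon x M :: 'a"
  have D: "lin_indep_on (UNIV \<times> {M. reduced q M}) ?D"
    using lin_indep_on_tensor[OF lin_indep_on_coordinates[where 'a='a] lin_indep_on_mon[where 'a='a]] by (simp add: q case_prod_unfold)
  define K where "K = fst ` comm_terms q ` T \<union> snd ` comm_terms q ` T"
  \<comment> \<open>\<open>A p c\<close> is the coefficient of the function indexed by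
    \<open>p\<close> in the value of \<open>c\<close>.\<close>
  define A where "A p c = (if p = fst (comm_terms q c) then 1 else 0)
      - (if p = snd (comm_terms q c) then 1 else 0 :: 'a)" for p c
  have K: "finite K" using T(1) by (simp add: K_def)
  have red: "reduced q (M - N)" if "reduced q M" for M N
    using that by (auto simp: reduced_def intro: le_less_trans[OF diff_le_self])
  have "reduced q M \<Longrightarrow> l \<notin># M \<Longrightarrow> reduced q (M + replicate_mset (q - 1) l)" for l M
    using q2 by (auto simp: reduced_def not_in_iff)
  then have terms: "snd (fst (comm_terms q c)) \<in> {M. reduced q M} \<and> snd (snd (comm_terms q c)) \<in> {M. reduced q M}"
    if "valid_comm q c" for c
    using that red by (cases c) auto
  have K_sub: "K \<subseteq> UNIV \<times> {M. reduced q M}"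
  proof
    fix p assume "p \<in> K"
    then obtain c where c: "c \<in> T" "p = fst (comm_terms q c) \<or> p = snd (comm_terms q c)"
      by (auto simp: K_def)
    then have "valid_comm q c" using T(2) by auto
    from terms[OF this] c(2) show "p \<in> UNIV \<times> {M. reduced q M}" by (auto simp: mem_Times_iff)
  qed
  have value_expand: "(case z of (d, x) \<Rightarrow> comm_value q c d x) = (\<Sum>p\<in>K. A p c * ?D p z)" if "c \<in> T" for c z
  proof -
    have in_K: "fst (comm_terms q c) \<in> K" "snd (comm_terms q c) \<in> K" using that by (auto simp: K_def)
    have "(\<Sum>p\<in>K. A p c * ?D p z) = ?D (fst (comm_terms q c)) z - ?D (snd (comm_terms q c)) z"
      using K in_K by (simp add: A_def left_diff_distrib sum_subtractf if_distrib[of "\<lambda>a. a * _"] cong: if_cong)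
    then show ?thesis by (cases c) (auto split: prod.splits)
  qed
  have coeff: "(\<Sum>c\<in>T. k c * A p c) = 0" if p: "p \<in> K" for p
  proof (rule lin_indep_onD[OF D K K_sub _ p])
    fix z
    have "(\<Sum>p\<in>K. (\<Sum>c\<in>T. k c * A p c) * ?D p z) = (\<Sum>c\<in>T. k c * (\<Sum>p\<in>K. A p c * ?D p z))"
      unfolding sum_distrib_right sum_distrib_left by (subst sum.swap) (simp add: mult.assoc)
    also have "\<dots> = 0" using eq[rule_format, of z] by (simp add: value_expand)
    finally show "(\<Sum>p\<in>K. (\<Sum>c\<in>T. k c * A p c) * ?D p z) = 0" .
  qed
  have lead: "k c = 0" if "c \<in> T" and "\<And>c'. c' \<in> T \<Longrightarrow> c' \<noteq> c \<Longrightarrow> k c' * A (fst (comm_terms q c)) c' = 0"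
    and "A (fst (comm_terms q c)) c = 1" for c
  proof -
    have "(\<Sum>c'\<in>T - {c}. k c' * A (fst (comm_terms q c)) c') = 0"
      by (rule sum.neutral) (use that(2) in auto)
    then have "(\<Sum>c'\<in>T. k c' * A (fst (comm_terms q c)) c') = k c"
      using sum.remove[OF T(1) that(1), of "\<lambda>c'. k c' * A (fst (comm_terms q c)) c'"] that(3) by simp
    then show ?thesis using coeff that(1) by (auto simp: K_def)
  qed
  have Power: "k (Power l M) = 0" if "Power l M \<in> T" for l M
  proof (rule lead[OF that])
    have M: "l \<notin># M" using that T(2) by auto
    then have cnt: "count (M + replicate_mset (q - 1) l) l = q - 1" by (simp add: not_in_iff)
    \<comment> \<open>A reduced \<open>N\<close> contains \<open>l\<close> at most
      \<open>q - 1\<close> times, so after removal fewer than \<open>q - 1\<close> copies are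
      left.\<close>
    have ne: "M + replicate_mset (q - 1) l \<noteq> N - {#l#}" if "reduced q N" for N
    proof
      assume "M + replicate_mset (q - 1) l = N - {#l#}"
      then have "count (N - {#l#}) l = q - 1" using cnt by simp
      then show False using that q2 by (auto simp: reduced_def dest: spec[of _ l])
    qed
    have ne': "M + replicate_mset (q - 1) l \<noteq> N" if "l \<notin># N" for N
      using cnt that q2 by (auto simp: not_in_iff)
    then show "A (fst (comm_terms q (Power l M))) (Power l M) = 1"
      using M q2 by (auto simp: A_def)
    fix c' assume c': "c' \<in> T" "c' \<noteq> Power l M"
    then have v: "valid_comm q c'" using T(2) by auto
    have "A (fst (comm_terms q (Power l M))) c' = 0"
    proof (cases c')
      case (Comm j m N)
      then show ?thesis using v ne[of N] by (auto simp: A_def)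
    next
      case (Power l' N)
      then show ?thesis using v c' ne'[of N] by (auto simp: A_def)
    qed
    then show "k c' * A (fst (comm_terms q (Power l M))) c' = 0" by simp
  qed
  have Comm: "k (Comm j m M) = 0" if "Comm j m M \<in> T" for j m M
  proof (rule lead[OF that])
    have v: "valid_comm q (Comm j m M)" using that T(2) by auto
    show "A (fst (comm_terms q (Comm j m M))) (Comm j m M) = 1" using v by (auto simp: A_def)
    fix c' assume c': "c' \<in> T" "c' \<noteq> Comm j m M"
    then have v': "valid_comm q c'" using T(2) by auto
    show "k c' * A (fst (comm_terms q (Comm j m M))) c' = 0"
    proof (cases c')
      case (Power l N)
      then show ?thesis using \<open>\<And>l M. Power l M \<in> T \<Longrightarrow> k (Power l M) = 0\<close> c'(1) by simp
    next
      case (Comm j' m' N)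
      \<comment> \<open>In a valid index the multiset determines \<open>m\<close> as its minimum, so
        equal first terms force equal indices. Agreement with the second term of \<open>c'\<close>
        would make \<open>j\<close> this minimum, against \<open>m < j\<close>.\<close>
      have "N = M" if "N - {#i#} = M - {#i#}" "i \<in># N" "i \<in># M" for i
        using that by (metis insert_DiffM)
      moreover have "m = m'" if "N = M" using v v' that Comm by (auto intro: antisym)
      ultimately have "(j, M - {#j#}) \<noteq> (j', N - {#j'#})" "(j, M - {#j#}) \<noteq> (m', N - {#m'#})"
        using v v' c'(2) Comm by force+
      then have "A (fst (comm_terms q (Comm j m M))) c' = 0"
        unfolding A_def Comm comm_terms.simps fst_conv snd_conv by (simp only: if_False diff_self)
      then show ?thesis by simp
    qed
  qed
  show "k c = 0" using Power Comm c by (cases c) auto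
qed

text \<open>The diagonal \<open>a, a + e, a + e + x\<close> makes its consecutive differences free
  parameters: commutation with \<open>Y i\<close> multiplies the \<open>e12\<close> part by
  \<open>e i\<close> and the \<open>e23\<close> part by \<open>x i\<close>. Odd variables are
  multiples of \<open>e12\<close>, which multiplied by a value in the \<open>e23\<close> line lands
  in \<open>e13\<close>.\<close>

definition generic_point :: "(nat \<Rightarrow> 'a) \<Rightarrow> (nat \<Rightarrow> 'a) \<Rightarrow> (nat \<Rightarrow> 'a) \<Rightarrow> (nat \<Rightarrow> 'a) \<Rightarrow> (nat \<Rightarrow> 'a)
    \<Rightarrow> var \<Rightarrow> 'a::field^3^3" where
  "generic_point a e x d u v = (case v of
     Y i \<Rightarrow> (\<chi> r s. if r = 1 \<and> s = 1 then a i else if r = 2 \<and> s = 2 then a i + e i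
        else if r = 3 \<and> s = 3 then a i + e i + x i else if r = 2 \<and> s = 3 then d i else 0)
   | Z j \<Rightarrow> (\<chi> r s. if r = 1 \<and> s = 2 then u j else 0))"

lemma graded_generic_point: "graded_assignment (generic_point a e x d u)"
  by (simp add: graded_assignment_def UT3_even_iff UT3_odd_iff generic_point_def)

lemma generic_point_entries:
  "generic_point a e x d u (Y i) $1$1 = a i" "generic_point a e x d u (Y i) $2$2 = a i + e i"
  "generic_point a e x d u (Y i) $3$3 = a i + e i + x i" "generic_point a e x d u (Y i) $2$3 = d i"
  "generic_point a e x d u (Z i) $1$2 = u i"
  by (simp_all add: generic_point_def)

lemma eval_basis_poly:
  fixes a e x d u :: "nat \<Rightarrow> 'a::{field, finite}"
  assumes q: "q = CARD('a)"
  defines "ev \<equiv> \<lambda>i. poly_eval (generic_point a e x d u) (basis_poly q i)"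
  shows "ev (R, None, None) \<in> UT3_even" "ev (R, None, None) $1$1 = mon a R"
    "valid_comm q c \<Longrightarrow> ev (R, None, Some c) = e23 (mon (\<lambda>i. a i + e i) R * comm_value q c d x)"
    "ev (R, Some (j, M), None) \<in> UT3_odd" "ev (R, Some (j, M), None) $1$2 = mon a R * (u j * mon e M)"
    "valid_comm q c \<Longrightarrow> ev (R, Some (j, M), Some c) =
       mat_scale (mon a R * (u j * mon e M) * comm_value q c d x) (e_mat 1 3)"
proof -
  let ?\<sigma> = "generic_point a e x d u"
  note g = graded_generic_point[of a e x d u]
  note yw = eval_yword[OF g, of "word_of R", unfolded generic_point_entries mset_sorted_list_of_multiset]
  have z: "poly_eval ?\<sigma> (zvar j) \<in> UT3_odd" "poly_eval ?\<sigma> (zvar j) $1$2 = u j"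
    using g by (simp_all add: graded_assignment_def generic_point_entries)
  note zw = eval_ad_word_odd[OF g z(1), of "word_of M", unfolded z(2) generic_point_entries
      mset_sorted_list_of_multiset add_diff_cancel_left']
  have c: "poly_eval ?\<sigma> (comm_poly q c) = e23 (comm_value q c d x)" if "valid_comm q c"
    using eval_comm_poly[OF g that q] by (simp add: generic_point_entries)
  show "ev (R, None, None) \<in> UT3_even" "ev (R, None, None) $1$1 = mon a R"
    using yw by (simp_all add: ev_def)
  show "ev (R, None, Some c) = e23 (mon (\<lambda>i. a i + e i) R * comm_value q c d x)" if "valid_comm q c"
    using yw by (simp add: ev_def poly_eval_mult c[OF that] mat_3_eq_iff matrix_mult_entry_3 UT3_even_iff)
  show 1: "ev (R, Some (j, M), None) \<in> UT3_odd" and 2: "ev (R, Some (j, M), None) $1$2 = mon a R * (u j * mon e M)"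
    using yw zw UT3_even_odd_mult by (simp_all add: ev_def poly_eval_mult matrix_mult_entry_3 UT3_even_iff UT3_odd_iff)
  show "ev (R, Some (j, M), Some c) =
       mat_scale (mon a R * (u j * mon e M) * comm_value q c d x) (e_mat 1 3)" if "valid_comm q c"
  proof -
    have "ev (R, Some (j, M), Some c) = ev (R, Some (j, M), None) ** e23 (comm_value q c d x)"
      by (simp add: ev_def poly_eval_mult c[OF that])
    also have "\<dots> = mat_scale (mon a R * (u j * mon e M) * comm_value q c d x) (e_mat 1 3)"
      using 1 2 by (simp add: mat_3_eq_iff matrix_mult_entry_3 UT3_odd_iff mat_scale_def e_mat_def)
    finally show ?thesis .
  qed
qed

lemma poly_eval_sum: "poly_eval \<sigma> (\<Sum>i\<in>T. f i) = (\<Sum>i\<in>T. poly_eval \<sigma> (f i))"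
  by (induction T rule: infinite_finite_induct) (simp_all add: poly_eval_add)

lemma basis_index_cases:
  fixes i :: basis_index
  obtains R where "i = (R, None, None)" | R c where "i = (R, None, Some c)"
  | R j M where "i = (R, Some (j, M), None)" | R j M c where "i = (R, Some (j, M), Some c)"
  by (metis option.exhaust surj_pair)

text \<open>The elimination is triangular: pure \<open>y\<close>-words may also contribute to the
  (2,3) entry, and products with a \<open>z\<close> but no \<open>p\<close> to the (1,3) entry, so
  their coefficients are removed first. In each entry the surviving values form a tensor product of
  independent families.\<close>

lemma basis_poly_independent_mod_Id:
  fixes k :: "basis_index \<Rightarrow> 'a::{field, finite}"
  assumes q: "q = CARD('a)" and T: "finite T" "T \<subseteq> basis_indices q"
    and Id: "(\<Sum>i\<in>T. fscale (k i) (basis_poly q i)) \<in> Id_UT3" and i: "i \<in> T"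
  shows "k i = 0"
proof -
  let ?ev = "\<lambda>a e x d u i. poly_eval (generic_point a e x d u) (basis_poly q i) :: 'a^3^3"
  have zero: "(\<Sum>i\<in>T. k i * ?ev a e x d u i $ r $ s) = 0" for a e x d u r s
  proof -
    have "poly_eval (generic_point a e x d u) (\<Sum>i\<in>T. fscale (k i) (basis_poly q i)) = 0"
      using Id graded_generic_point unfolding Id_UT3_iff by blast
    then have "(\<Sum>i\<in>T. mat_scale (k i) (?ev a e x d u i)) = 0"
      by (simp only: poly_eval_sum poly_eval_fscale)
    from arg_cong[OF this, of "\<lambda>A. A $ r $ s"] show ?thesis by (simp add: mat_scale_def)
  qed
  note ev = eval_basis_poly[OF q]
  have ev4: "?ev a e x d u (R, Some (j, M), None) $1$1 = 0" for a e x d u R j M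
    using ev(4) by (simp add: UT3_odd_iff del: basis_poly.simps)
  have mon: "lin_indep_on {M. reduced q M} (\<lambda>M (x :: nat \<Rightarrow> 'a). mon x M)"
    unfolding q by (rule lin_indep_on_mon)
  note val = lin_indep_on_comm_value[OF q]
  note coord = lin_indep_on_coordinates[where 'a='a]
  have red: "reduced q R" if "(R, zo, co) \<in> T" for R zo co using that T(2) by (auto simp: basis_indices_def)
  have redM: "reduced q M" if "(R, Some (j, M), co) \<in> T" for R j M co
    using that T(2) by (auto simp: basis_indices_def)
  have vc: "valid_comm q c" if "(R, zo, Some c) \<in> T" for R zo c
    using that T(2) by (auto simp: basis_indices_def)
  have k00: "k (R, None, None) = 0" if R: "(R, None, None) \<in> T" for R
  proof (rule lin_indep_on_reindexD[OF mon, of "T \<inter> {(R, None, None) |R. True}" fst k])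
    fix a
    have "(\<Sum>i\<in>T \<inter> {(R, None, None) |R. True}. k i * mon a (fst i))
        = (\<Sum>i\<in>T. k i * ?ev a (\<lambda>_. 0) (\<lambda>_. 0) (\<lambda>_. 0) (\<lambda>_. 0) i $1$1)"
    proof (rule sum.mono_neutral_cong_left)
      show "\<forall>i\<in>T - T \<inter> {(R, None, None) |R. True}. k i * ?ev a (\<lambda>_. 0) (\<lambda>_. 0) (\<lambda>_. 0) (\<lambda>_. 0) i $1$1 = 0"
      proof
        fix i assume "i \<in> T - T \<inter> {(R, None, None) |R. True}"
        then show "k i * ?ev a (\<lambda>_. 0) (\<lambda>_. 0) (\<lambda>_. 0) (\<lambda>_. 0) i $1$1 = 0"
          using vc
          by (cases i rule: basis_index_cases) (auto simp: ev(3,6) ev4 mat_scale_def e_mat_def simp del: basis_poly.simps)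
      qed
    qed (use T(1) ev(2) in \<open>auto simp del: basis_poly.simps\<close>)
    then show "(\<Sum>i\<in>T \<inter> {(R, None, None) |R. True}. k i * mon a (fst i)) = 0" using zero by simp
  qed (use R T(1) red in \<open>auto intro!: inj_onI\<close>)
  have k10: "k (R, Some (j, M), None) = 0" if R: "(R, Some (j, M), None) \<in> T" for R j M
  proof (rule lin_indep_on_reindexD[OF lin_indep_on_tensor[OF mon lin_indep_on_tensor[OF coord mon]],
        of "T \<inter> {(R, Some (j, M), None) |R j M. True}" "\<lambda>(R, zo, co). (R, the zo)" k])
    fix z :: "(nat \<Rightarrow> 'a) \<times> (nat \<Rightarrow> 'a) \<times> (nat \<Rightarrow> 'a)"
    obtain a u e where z: "z = (a, u, e)" by (cases z) auto
    let ?f = "\<lambda>i. (case i of (R, zo, co) \<Rightarrow> (R, the zo))"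
    have "(\<Sum>i\<in>T \<inter> {(R, Some (j, M), None) |R j M. True}.
          k i * (case ?f i of (i, j) \<Rightarrow> \<lambda>(x, y). mon x i * (case j of (i, j) \<Rightarrow> \<lambda>(x, y). x i * mon y j) y) z)
        = (\<Sum>i\<in>T. k i * ?ev a e (\<lambda>_. 0) (\<lambda>_. 0) u i $1$2)"
    proof (rule sum.mono_neutral_cong_left)
      show "\<forall>i\<in>T - T \<inter> {(R, Some (j, M), None) |R j M. True}. k i * ?ev a e (\<lambda>_. 0) (\<lambda>_. 0) u i $1$2 = 0"
      proof
        fix i assume "i \<in> T - T \<inter> {(R, Some (j, M), None) |R j M. True}"
        then show "k i * ?ev a e (\<lambda>_. 0) (\<lambda>_. 0) u i $1$2 = 0"
          using vc k00
          by (cases i rule: basis_index_cases) (auto simp: ev(3,6) mat_scale_def e_mat_def simp del: basis_poly.simps)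
      qed
    qed (use T(1) ev(5) in \<open>auto simp: z simp del: basis_poly.simps\<close>)
    then show "(\<Sum>i\<in>T \<inter> {(R, Some (j, M), None) |R j M. True}.
          k i * (case ?f i of (i, j) \<Rightarrow> \<lambda>(x, y). mon x i * (case j of (i, j) \<Rightarrow> \<lambda>(x, y). x i * mon y j) y) z) = 0"
      using zero by simp
  qed (use R T(1) red redM in \<open>auto intro!: inj_onI\<close>)
  have k01: "k (R, None, Some c) = 0" if R: "(R, None, Some c) \<in> T" for R c
  proof (rule lin_indep_on_reindexD[OF lin_indep_on_tensor[OF mon val],
        of "T \<inter> {(R, None, Some c) |R c. True}" "\<lambda>(R, zo, co). (R, the co)" k])
    fix z :: "(nat \<Rightarrow> 'a) \<times> (nat \<Rightarrow> 'a) \<times> (nat \<Rightarrow> 'a)"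
    obtain b d x where z: "z = (b, d, x)" by (cases z) auto
    let ?f = "\<lambda>i. (case i of (R, zo, co) \<Rightarrow> (R, the co))"
    \<comment> \<open>With \<open>a = 0\<close> the parameter \<open>b\<close> is the (2,2) entry
      itself, so the \<open>y\<close>-word contributes a monomial in \<open>b\<close> and not a
      product of sums.\<close>
    have "(\<Sum>i\<in>T \<inter> {(R, None, Some c) |R c. True}.
          k i * (case ?f i of (i, j) \<Rightarrow> \<lambda>(x, y). mon x i * (case y of (d, x) \<Rightarrow> comm_value q j d x)) z)
        = (\<Sum>i\<in>T. k i * ?ev (\<lambda>_. 0) b x d (\<lambda>_. 0) i $2$3)"
    proof (rule sum.mono_neutral_cong_left)
      show "\<forall>i\<in>T - T \<inter> {(R, None, Some c) |R c. True}. k i * ?ev (\<lambda>_. 0) b x d (\<lambda>_. 0) i $2$3 = 0"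
      proof
        fix i assume "i \<in> T - T \<inter> {(R, None, Some c) |R c. True}"
        then show "k i * ?ev (\<lambda>_. 0) b x d (\<lambda>_. 0) i $2$3 = 0"
          using vc k00 k10
          by (cases i rule: basis_index_cases) (auto simp: ev(3,6) mat_scale_def e_mat_def simp del: basis_poly.simps)
      qed
    qed (use T(1) vc in \<open>auto simp: z ev(3) simp del: basis_poly.simps\<close>)
    then show "(\<Sum>i\<in>T \<inter> {(R, None, Some c) |R c. True}.
          k i * (case ?f i of (i, j) \<Rightarrow> \<lambda>(x, y). mon x i * (case y of (d, x) \<Rightarrow> comm_value q j d x)) z) = 0"
      using zero by simp
  qed (use R T(1) red vc in \<open>auto intro!: inj_onI\<close>)
  have k11: "k (R, Some (j, M), Some c) = 0" if R: "(R, Some (j, M), Some c) \<in> T" for R j M c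
  proof (rule lin_indep_on_reindexD[OF lin_indep_on_tensor[OF lin_indep_on_tensor[OF mon lin_indep_on_tensor[OF coord mon]] val],
        of "T \<inter> {(R, Some (j, M), Some c) |R j M c. True}" "\<lambda>(R, zo, co). ((R, the zo), the co)" k])
    fix z :: "((nat \<Rightarrow> 'a) \<times> (nat \<Rightarrow> 'a) \<times> (nat \<Rightarrow> 'a)) \<times> (nat \<Rightarrow> 'a) \<times> (nat \<Rightarrow> 'a)"
    obtain a u e d x where z: "z = ((a, u, e), (d, x))" by (cases z) auto
    let ?f = "\<lambda>i. (case i of (R, zo, co) \<Rightarrow> ((R, the zo), the co))"
    have "(\<Sum>i\<in>T \<inter> {(R, Some (j, M), Some c) |R j M c. True}.
          k i * (case ?f i of (i, j) \<Rightarrow> \<lambda>(x, y). (case i of (i, j) \<Rightarrow>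
            \<lambda>(x, y). mon x i * (case j of (i, j) \<Rightarrow> \<lambda>(x, y). x i * mon y j) y) x
              * (case y of (d, x) \<Rightarrow> comm_value q j d x)) z)
        = (\<Sum>i\<in>T. k i * ?ev a e x d u i $1$3)"
    proof (rule sum.mono_neutral_cong_left)
      show "\<forall>i\<in>T - T \<inter> {(R, Some (j, M), Some c) |R j M c. True}. k i * ?ev a e x d u i $1$3 = 0"
      proof
        fix i assume "i \<in> T - T \<inter> {(R, Some (j, M), Some c) |R j M c. True}"
        then show "k i * ?ev a e x d u i $1$3 = 0"
          using k00 k10 k01
          by (cases i rule: basis_index_cases) (auto simp del: basis_poly.simps)
      qed
    qed (use T(1) vc in \<open>auto simp: z ev(6) mat_scale_def e_mat_def simp del: basis_poly.simps\<close>)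
    then show "(\<Sum>i\<in>T \<inter> {(R, Some (j, M), Some c) |R j M c. True}.
          k i * (case ?f i of (i, j) \<Rightarrow> \<lambda>(x, y). (case i of (i, j) \<Rightarrow>
            \<lambda>(x, y). mon x i * (case j of (i, j) \<Rightarrow> \<lambda>(x, y). x i * mon y j) y) x
              * (case y of (d, x) \<Rightarrow> comm_value q j d x)) z) = 0"
      using zero by simp
  qed (use R T(1) red redM vc in \<open>auto intro!: inj_onI\<close>)
  show ?thesis using i k00 k10 k01 k11 by (cases i rule: basis_index_cases) auto
qed

section \<open>The relatively free algebra\<close>

lemma abs_relfree_eq_iff: "abs_relfree f = abs_relfree g \<longleftrightarrow> f - g \<in> Id_UT3"
  by (rule relfree.abs_eq_iff)

lemma abs_relfree_add: "abs_relfree (f + g) = abs_relfree f + abs_relfree g"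
  by (simp add: plus_relfree.abs_eq)

lemma abs_relfree_fscale: "abs_relfree (fscale c f) = rscale c (abs_relfree f)"
  by (simp add: rscale.abs_eq)

lemma abs_relfree_0: "abs_relfree 0 = 0"
  by (simp add: zero_relfree_def)

lemma abs_relfree_lincomb:
  "abs_relfree (\<Sum>f\<in>T. fscale (k f) f) = (\<Sum>f\<in>T. rscale (k f) (abs_relfree f))"
  by (induction T rule: infinite_finite_induct)
     (simp_all add: abs_relfree_0 abs_relfree_add abs_relfree_fscale)

lemma basis_polys_independent_mod_Id:
  fixes k :: "'a::{field, finite} fpoly \<Rightarrow> 'a"
  assumes q: "q = CARD('a)" and S: "finite S" "S \<subseteq> basis_polys q"
    and Id: "(\<Sum>f\<in>S. fscale (k f) f) \<in> Id_UT3" and f: "f \<in> S"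
  shows "k f = 0"
proof -
  have "S \<subseteq> basis_poly q ` basis_indices q"
    using S(2) basis_polys_eq_image[where 'a='a, of q] by (simp add: q)
  then obtain T where T: "T \<subseteq> basis_indices q" "inj_on (basis_poly q :: _ \<Rightarrow> 'a fpoly) T" "S = basis_poly q ` T"
    unfolding subset_image_inj by blast
  obtain i where i: "i \<in> T" "f = basis_poly q i" using f T(3) by blast
  have "finite T" using S(1) T(2,3) finite_imageD by blast
  moreover have "(\<Sum>i\<in>T. fscale (k (basis_poly q i)) (basis_poly q i)) \<in> Id_UT3"
    using Id T(2) by (simp add: T(3) sum.reindex del: basis_poly.simps)
  ultimately show ?thesis
    using basis_poly_independent_mod_Id[OF q _ T(1) _ i(1), of "\<lambda>i. k (basis_poly q i)"] i(2) by blast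
qed

lemma inj_on_abs_relfree_basis_polys:
  assumes q: "q = CARD('a::{field, finite})"
  shows "inj_on abs_relfree (basis_polys q :: 'a fpoly set)"
proof (rule inj_onI, rule ccontr)
  fix f g :: "'a fpoly"
  assume fg: "f \<in> basis_polys q" "g \<in> basis_polys q" "abs_relfree f = abs_relfree g" "f \<noteq> g"
  \<comment> \<open>Equal images would give the relation \<open>f - g\<close> between two distinct
    basis polynomials.\<close>
  let ?k = "\<lambda>h. if h = f then 1 else - 1 :: 'a"
  have "(\<Sum>h\<in>{f, g}. fscale (?k h) h) \<in> Id_UT3"
    using fg by (simp add: abs_relfree_eq_iff free.scale_minus_left)
  then have "?k f = 0" using fg by (intro basis_polys_independent_mod_Id[OF q, of "{f, g}" ?k]) auto
  then show False by simp
qed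

lemma independent_basis_polys:
  assumes q: "q = CARD('a::{field, finite})"
  shows "quot.independent (abs_relfree ` (basis_polys q :: 'a fpoly set))"
  unfolding quot.independent_explicit_finite_subsets
proof (intro allI impI ballI)
  fix S u v
  assume S: "S \<subseteq> abs_relfree ` (basis_polys q :: 'a fpoly set)" "finite S"
    and eq: "(\<Sum>v\<in>S. rscale (u v) v) = 0" and v: "v \<in> S"
  obtain T :: "'a fpoly set" where T: "T \<subseteq> basis_polys q" "inj_on abs_relfree T" "S = abs_relfree ` T"
    using S(1) unfolding subset_image_inj by blast
  obtain f where f: "f \<in> T" "v = abs_relfree f" using v T(3) by blast
  have "finite T" using S(2) T(2,3) finite_imageD by blast
  moreover have "abs_relfree (\<Sum>f\<in>T. fscale (u (abs_relfree f)) f) = 0"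
    using eq T(2) by (simp add: abs_relfree_lincomb T(3) sum.reindex)
  then have "(\<Sum>f\<in>T. fscale (u (abs_relfree f)) f) \<in> Id_UT3"
    by (simp add: abs_relfree_0[symmetric] abs_relfree_eq_iff)
  ultimately show "u v = 0"
    using basis_polys_independent_mod_Id[OF q _ T(1) _ f(1), of "\<lambda>f. u (abs_relfree f)"] f(2) by blast
qed

lemma ad_word_in_FYZ: "t \<in> FYZ \<Longrightarrow> ad_word w t \<in> FYZ"
  by (induction w arbitrary: t) (simp_all add: comm_def free.subspace_diff[OF subspace_FYZ] FYZ_mult)

lemma basis_polys_subset_FYZ:
  assumes q: "q > 0"
  shows "(basis_polys q :: 'a::field fpoly set) \<subseteq> FYZ"
proof -
  have "(basis_poly q (R, zo, co) :: 'a fpoly) \<in> FYZ" if "R \<noteq> {#} \<or> zo \<noteq> None \<or> co \<noteq> None" for R zo co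
  proof -
    have "(yword (word_of R) :: 'a fpoly) \<in> FYZ" if "R \<noteq> {#}"
      using that by (simp add: yword_def) (metis mset_sorted_list_of_multiset mset_zero_iff)
    moreover have z: "(zvar j :: 'a fpoly) \<in> FYZ" for j by (simp add: zvar_def)
    have "(z_factor zo :: 'a fpoly) \<in> FYZ" if "zo \<noteq> None"
      using that by (cases zo) (auto intro!: ad_word_in_FYZ z)
    moreover have y: "(yvar i :: 'a fpoly) \<in> FYZ" for i by (simp add: yvar_def)
    then have "(comm_poly q c :: 'a fpoly) \<in> FYZ" for c
      using q power_in_F_even[OF yvar_in_F_even, of q] F_even_subset_FYZ
      by (cases c) (auto intro!: ad_word_in_FYZ free.subspace_diff[OF subspace_FYZ])
    then have "(comm_factor q co :: 'a fpoly) \<in> FYZ" if "co \<noteq> None" using that by (cases co) auto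
    ultimately show ?thesis using that by (auto simp: FYZ_mult)
  qed
  then show ?thesis unfolding basis_polys_eq_image[OF q] basis_indices_def by blast
qed

lemma generated_ideal_Id_UT3:
  "q = CARD('a::{field, finite}) \<Longrightarrow> generated_ideal (Id_UT3 :: 'a fpoly set) q"
  by (simp only: generated_ideal_def T2_ideal_Id_UT3 generators_in_Id_UT3 simp_thms)

lemma span_basis_polys:
  assumes q: "q = CARD('a::{field, finite})"
  shows "quot.span (abs_relfree ` (basis_polys q :: 'a fpoly set)) = abs_relfree ` FYZ"
proof
  interpret generated_ideal "Id_UT3 :: 'a fpoly set" q by (rule generated_ideal_Id_UT3[OF q])
  have "quot.subspace (abs_relfree ` (FYZ :: 'a fpoly set))"
  proof (rule quot.subspaceI)
    show "0 \<in> abs_relfree ` (FYZ :: 'a fpoly set)"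
      using abs_relfree_0 free.subspace_0[OF subspace_FYZ] by (metis imageI)
  qed (auto simp: abs_relfree_add[symmetric] abs_relfree_fscale[symmetric]
      intro!: imageI free.subspace_add[OF subspace_FYZ] free.subspace_scale[OF subspace_FYZ])
  then show "quot.span (abs_relfree ` (basis_polys q :: 'a fpoly set)) \<subseteq> abs_relfree ` FYZ"
    using basis_polys_subset_FYZ[of q] q_ge_2 by (intro quot.span_minimal image_mono) auto
  have span: "abs_relfree g \<in> quot.span (abs_relfree ` (basis_polys q :: 'a fpoly set))"
    if "g \<in> free.span (basis_polys q)" for g :: "'a fpoly"
    using that
    by (induction rule: free.span_induct_alt)
       (simp_all add: abs_relfree_0 abs_relfree_add abs_relfree_fscale
         quot.span_zero quot.span_add quot.span_scale quot.span_base)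
  show "abs_relfree ` FYZ \<subseteq> quot.span (abs_relfree ` (basis_polys q :: 'a fpoly set))"
  proof clarify
    fix f :: "'a fpoly" assume "f \<in> FYZ"
    then obtain g where "g \<in> free.span (basis_polys q)" "f - g \<in> Id_UT3"
      using FYZ_decomposition by blast
    then show "abs_relfree f \<in> quot.span (abs_relfree ` basis_polys q)"
      using span[of g] abs_relfree_eq_iff[of f g] by simp
  qed
qed

lemma T2_ideal_Int: "T2_ideal I \<Longrightarrow> T2_ideal J \<Longrightarrow> T2_ideal (I \<inter> J)"
  unfolding T2_ideal_def by (auto simp: image_subset_iff intro: free.subspace_inter)

theorem theorem2:
  fixes q :: nat
  assumes "q = CARD('a::{field, finite})"
  shows "T2_generated
           ({zvar 0 * zvar 1} \<union> {w1 * zvar 0 |w1. w1 \<in> Omega1 q}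
             \<union> {w1 * w2 |w1 w2. w1 \<in> Omega1 q \<and> w2 \<in> Omega2 q})
         = (Id_UT3 :: 'a fpoly set)
       \<and> inj_on abs_relfree (basis_polys q :: 'a fpoly set)
       \<and> quot.independent (abs_relfree ` (basis_polys q :: 'a fpoly set))
       \<and> quot.span (abs_relfree ` (basis_polys q :: 'a fpoly set)) = abs_relfree ` FYZ"
proof (intro conjI)
  let ?S = "{zvar 0 * zvar 1} \<union> {w1 * zvar 0 |w1. w1 \<in> Omega1 q}
             \<union> {w1 * w2 |w1 w2. w1 \<in> Omega1 q \<and> w2 \<in> Omega2 q} :: 'a fpoly set"
  note gens = generators_in_Id_UT3[OF assms]
  have "Id_UT3 \<subseteq> J" if J: "T2_ideal J" "?S \<subseteq> J" for J
  proof
    fix f :: "'a fpoly" assume f: "f \<in> Id_UT3"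
    \<comment> \<open>\<open>J\<close> need not consist of identities. The intersection still
      contains the generators, and \<open>f - g\<close> in it makes \<open>g\<close> an identity, so
      independence applies to \<open>g\<close>.\<close>
    interpret generated_ideal "J \<inter> Id_UT3" q
      using assms T2_ideal_Int[OF J(1) T2_ideal_Id_UT3] J(2) gens
      by unfold_locales (assumption, assumption, blast)
    have "f \<in> FYZ" using f by (simp add: super_ids_def)
    then obtain g where g: "g \<in> free.span (basis_polys q)" "f - g \<in> J \<inter> Id_UT3"
      using FYZ_decomposition by blast
    have "g \<in> Id_UT3"
      using free.subspace_diff[OF subspace_super_ids f, of "f - g"] g(2) by simp
    moreover obtain S k where S: "finite S" "S \<subseteq> basis_polys q" "g = (\<Sum>h\<in>S. fscale (k h) h)"
      using g(1) unfolding free.span_explicit by blast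
    ultimately have "k h = 0" if "h \<in> S" for h
      using basis_polys_independent_mod_Id[OF assms S(1,2) _ that] by blast
    then have "g = 0" by (simp add: S(3))
    with g(2) show "f \<in> J" by simp
  qed
  then show "T2_generated ?S = Id_UT3"
    using T2_ideal_Id_UT3 gens unfolding T2_generated_def by blast
qed (use assms in \<open>rule inj_on_abs_relfree_basis_polys independent_basis_polys span_basis_polys\<close>)+

end
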